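(* Let $n\geq 2$, $0<\alpha,\beta<2$ and $1<p<\infty$. Suppose that $u\in C^{1,1}_{loc}(\mathbb{R}^n)\cap L_{\alpha}$ and $v\in C^{1,1}_{loc}(\mathbb{R}^n)\cap L_{\beta}$, where $$v(x)= C_{n,-\beta}\int_{\mathbb{R}^n}\frac{u^p(y)}{|x-y|^{n-\beta}}\,dy ,$$ form a positive solution pair of the system $$\begin{cases}(-\Delta)^{\frac{\alpha}{2}} u(x)+u(x)=v(x)\,u^{p-1}(x), & x\in\mathbb{R}^n,\\ (-\Delta)^{\frac{\beta}{2}} v(x)=u^{p}(x), & x\in\mathbb{R}^n,\\ u(x)>0,\quad v(x)>0, & x\in\mathbb{R}^n.\end{cases}$$ Suppose further that there are constants $C_1,C_2,a,\gamma$ with $\gamma>\frac{\beta}{p-1}$ such that $$\frac{C_1}{|x|^{\gamma}}\leq u(x)\leq\frac{C_2}{|x|^{\gamma}}\quad\text{for } |x| \text{ sufficiently large},\qquad \lim_{|x|\to\infty}u^{p-2}(x)\,v(x)=a<\frac{C_1}{C_2\,p}.$$ Then $u$ is radially symmetric and monotone decreasing about some point of $\mathbb{R}^n$; that is, there exist $x_0\in\mathbb{R}^n$ and a monotone decreasing function $\varphi$ on $[0,\infty)$ such that $u(x)=\varphi(|x-x_0|)$ for all $x\in\mathbb{R}^n$.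
   Context: For $0<\alpha<2$, $L_\alpha=\{u\in L^1_{loc}(\mathbb{R}^n) : \int_{\mathbb{R}^n}\frac{|u(x)|}{1+|x|^{n+\alpha}}dx<\infty\}$. The fractional Laplacian is $$(-\Delta)^{\frac{\alpha}{2}}u(x)=C_{n,\alpha}\,PV\int_{\mathbb{R}^n}\frac{u(x)-u(y)}{|x-y|^{n+\alpha}}dy=C_{n,\alpha}\lim_{\varepsilon\to0^+}\int_{\mathbb{R}^n\setminus B_\varepsilon(x)}\frac{u(x)-u(y)}{|x-y|^{n+\alpha}}dy,$$ where $C_{n,\alpha}>0$ is the usual normalization constant; it is well defined pointwise for $u\in C^{1,1}_{loc}\cap L_\alpha$. The same definitions are used with $\beta$ in place of $\alpha$. The constant $C_{n,-\beta}>0$ is the usual Riesz potential normalization constant, $C_{n,-\beta}=\frac{\Gamma((n-\beta)/2)}{2^{\beta}\pi^{n/2}\Gamma(\beta/2)}$, for which $v=C_{n,-\beta}|x|^{\beta-n}\ast u^p$ corresponds to $(-\Delta)^{\beta/2}v=u^p$. *)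

theory Defs
  imports "HOL-Analysis.Analysis"
begin

definition C11_loc :: "('a::euclidean_space \<Rightarrow> real) \<Rightarrow> bool" where
  "C11_loc u \<longleftrightarrow>
     (\<exists>Du. (\<forall>x. GDERIV u x :> Du x) \<and>
           (\<forall>K. compact K \<longrightarrow> (\<exists>L. L-lipschitz_on K Du)))"

definition L_space :: "real \<Rightarrow> ('a::euclidean_space \<Rightarrow> real) set" where
  "L_space \<alpha> =
     {u. (\<forall>K. compact K \<longrightarrow> set_integrable lebesgue K u) \<and>
         integrable lebesgue (\<lambda>x. \<bar>u x\<bar> / (1 + norm x powr (real DIM('a) + \<alpha>)))}"

text \<open>
  The closed form of the inverse of the integral of
  \<open>(1 - cos \<zeta>\<^sub>1) / |\<zeta>|\<^sup>n\<^sup>+\<^sup>\<alpha>\<close> over \<open>\<zeta> \<in> \<real>\<^sup>n\<close>,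
  that is, the constant for which the fractional Laplacian has Fourier symbol
  \<open>|\<xi>|\<^sup>\<alpha>\<close>. Since \<open>Gamma (-\<alpha>/2) < 0\<close> for \<open>0 < \<alpha> < 2\<close>,
  the absolute value makes it positive.
\<close>

definition frac_laplacian_const :: "nat \<Rightarrow> real \<Rightarrow> real" where
  "frac_laplacian_const n \<alpha> =
     2 powr \<alpha> * Gamma ((real n + \<alpha>) / 2) / (pi powr (real n / 2) * \<bar>Gamma (- \<alpha> / 2)\<bar>)"

text \<open>
  \<open>frac_laplacian \<alpha>\<close> is the operator \<open>(-\<Delta>)\<^sup>\<alpha>\<^sup>/\<^sup>2\<close>. Outside the
  class \<open>C11_loc\<close> intersected with \<open>L_space \<alpha>\<close> (with \<open>0 < \<alpha> < 2\<close>), the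
  integral or the limit may fail to exist, and the value is then meaningless.
\<close>

definition frac_laplacian :: "real \<Rightarrow> ('a::euclidean_space \<Rightarrow> real) \<Rightarrow> 'a \<Rightarrow> real" where
  "frac_laplacian \<alpha> u x =
     frac_laplacian_const DIM('a) \<alpha> *
     Lim (at_right 0) (\<lambda>\<epsilon>.
       LINT y:(- ball x \<epsilon>)|lebesgue. (u x - u y) / norm (x - y) powr (real DIM('a) + \<alpha>))"

definition riesz_const :: "nat \<Rightarrow> real \<Rightarrow> real" where
  "riesz_const n \<beta> =
     Gamma ((real n - \<beta>) / 2) / (2 powr \<beta> * pi powr (real n / 2) * Gamma (\<beta> / 2))"

text \<open>
  The Bochner integral of a non-integrable function is \<open>0\<close>; hence, for
  \<open>0 < \<beta> < n\<close>, a positive value of \<open>riesz_potential \<beta> f x\<close> entails that the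
  defining integral converges.
\<close>

definition riesz_potential :: "real \<Rightarrow> ('a::euclidean_space \<Rightarrow> real) \<Rightarrow> 'a \<Rightarrow> real" where
  "riesz_potential \<beta> f x =
     riesz_const DIM('a) \<beta> *
     (LINT y|lebesgue. f y / norm (x - y) powr (real DIM('a) - \<beta>))"

end

theory Submission
  imports Defs
begin

text \<open>
  Moving planes, run directly on the nonlocal equation. For a unit vector \<open>e\<close> and \<open>l\<close> real let
  \<open>U = u \<circ> R - u\<close> and \<open>V = v \<circ> R - v\<close>, with \<open>R\<close> the reflection in \<open>{y. y \<bullet> e = l}\<close>. At a negative
  minimum \<open>x\<close> of \<open>U\<close> over the half-space \<open>{y. y \<bullet> e \<le> l}\<close>, at distance \<open>d\<close> from its boundary, the
  antisymmetry of \<open>U\<close> bounds its fractional Laplacian from above by \<open>c U(x) / d\<^sup>\<alpha>\<close>, and the Riesz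
  representation of \<open>v\<close> bounds \<open>V(x)\<close> from below by \<open>U(x)\<close> times the potential of \<open>u\<^sup>p\<^sup>-\<^sup>1\<close> restricted to
  \<open>S = {U < 0}\<close>. Dividing the equation for \<open>U\<close> by \<open>U(x)\<close> leaves
  \<open>1 + c / d\<^sup>\<alpha> \<le> C \<integral>\<^sub>S |x - y|\<^sup>\<beta>\<^sup>-\<^sup>n u\<^sup>p\<^sup>-\<^sup>1 dy + max 1 (p - 1) u\<^sup>p\<^sup>-\<^sup>2(x) v(x)\<close>.
  The integral is uniformly small if \<open>S\<close> has small measure inside a large ball, because
  \<open>\<gamma> (p - 1) > \<beta>\<close>; the last term is less than \<open>1\<close> near infinity, because \<open>a p < 1\<close>, and bounded
  elsewhere. Hence \<open>S\<close> is empty if inside that ball it lies in a thin strip along the boundary, which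
  both starts the sliding at \<open>l = -\<infinity>\<close> and continues it until \<open>u\<close> is symmetric.
\<close>

subsection \<open>Isometry invariance of Lebesgue measure\<close>

text \<open>By surjectivity \<open>t = f s\<close> for some \<open>s\<close>, and linearity of
  \<open>f\<close> turns translation by \<open>t\<close> after \<open>f\<close> into translation by
  \<open>s\<close> before it, where \<open>lborel\<close> is invariant.\<close>

lemma emeasure_distr_orthogonal_translate:
  fixes f :: "'a::euclidean_space \<Rightarrow> 'a"
  assumes f: "orthogonal_transformation f" and "b \<in> sets borel"
  shows "emeasure (distr lborel borel f) ((\<lambda>x. x + t) -` b) = emeasure (distr lborel borel f) b"
proof -
  have [measurable]: "f \<in> borel_measurable borel"
    using f by (intro borel_measurable_continuous_onI linear_continuous_on linear_linear[THEN iffD2]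
        orthogonal_transformation_linear)
  obtain s where s: "f s = t"
    using orthogonal_transformation_surj[OF f] by (metis surjD)
  note [measurable] = \<open>b \<in> sets borel\<close>
  have [measurable]: "(\<lambda>x. x + t) -` b \<in> sets borel"
    by (rule measurable_sets_borel[OF _ \<open>b \<in> sets borel\<close>]) simp
  have [measurable]: "f -` b \<in> sets borel"
    by (rule measurable_sets_borel[OF _ \<open>b \<in> sets borel\<close>]) simp
  have "emeasure (distr lborel borel f) ((\<lambda>x. x + t) -` b) = emeasure lborel (f -` (\<lambda>x. x + t) -` b)"
    by (subst emeasure_distr) auto
  also have "f -` (\<lambda>x. x + t) -` b = (+) s -` f -` b"
    using f by (auto simp: s[symmetric] orthogonal_transformation_linear linear_add add.commute)
  also have "emeasure lborel \<dots> = emeasure (distr lborel borel ((+) s)) (f -` b)"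
    by (subst emeasure_distr) auto
  also have "\<dots> = emeasure (distr lborel borel f) b"
    unfolding lborel_distr_plus by (subst emeasure_distr) auto
  finally show ?thesis .
qed

text \<open>
  Both \<open>lborel\<close> and its image \<open>\<nu>\<close> are translation invariant and agree on the unit ball \<open>B\<close>, so
  Fubini's theorem applied to \<open>1\<^sub>A(x) 1\<^sub>B(y)\<close> yields \<open>\<nu>(A) |B| = |A| \<nu>(B)\<close>.
\<close>

lemma distr_lborel_orthogonal:
  fixes f :: "'a::euclidean_space \<Rightarrow> 'a"
  assumes f: "orthogonal_transformation f"
  shows "distr lborel borel f = lborel"
proof -
  have [measurable]: "f \<in> borel_measurable borel"
    using f by (intro borel_measurable_continuous_onI linear_continuous_on linear_linear[THEN iffD2]
        orthogonal_transformation_linear)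
  define \<nu> where "\<nu> = distr lborel borel f"
  have sets_\<nu>[measurable_cong, simp]: "sets \<nu> = sets borel" by (simp add: \<nu>_def)
  have space_\<nu>[simp]: "space \<nu> = UNIV" by (simp add: \<nu>_def)
  have ball: "emeasure \<nu> (ball 0 r) = emeasure lborel (ball (0::'a) r)" for r
  proof -
    have "f -` ball 0 r = ball 0 r"
      using f by (auto simp: orthogonal_transformation)
    then show ?thesis unfolding \<nu>_def by (subst emeasure_distr) auto
  qed
  have trans: "emeasure \<nu> ((\<lambda>x. x + t) -` b) = emeasure \<nu> b" if "b \<in> sets borel" for t b
    unfolding \<nu>_def using emeasure_distr_orthogonal_translate[OF f that] .
  have dtrans: "distr \<nu> borel (\<lambda>x. x + t) = \<nu>" for t
  proof (rule measure_eqI)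
    fix A assume "A \<in> sets (distr \<nu> borel (\<lambda>x. x + t))"
    then have [measurable]: "A \<in> sets borel" by simp
    show "emeasure (distr \<nu> borel (\<lambda>x. x + t)) A = emeasure \<nu> A"
      by (subst emeasure_distr) (auto simp: trans)
  qed simp
  have balls: "emeasure \<nu> {x. y - x \<in> ball 0 1} = emeasure lborel (ball (0::'a) 1)" for y
  proof -
    have "{x. y - x \<in> ball 0 1} = (\<lambda>x. x + (-y)) -` ball 0 1"
      by (auto simp: norm_minus_commute)
    then show ?thesis using trans[of "ball 0 1" "-y"] ball by simp
  qed
  interpret \<nu>: sigma_finite_measure \<nu>
  proof
    show "\<exists>A. countable A \<and> A \<subseteq> sets \<nu> \<and> \<Union>A = space \<nu> \<and> (\<forall>a\<in>A. emeasure \<nu> a \<noteq> \<infinity>)"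
    proof (intro exI conjI)
      show "countable (range (\<lambda>n::nat. ball (0::'a) (real n)))" by simp
      show "range (\<lambda>n::nat. ball (0::'a) (real n)) \<subseteq> sets \<nu>" by auto
      show "\<Union>(range (\<lambda>n::nat. ball (0::'a) (real n))) = space \<nu>"
        by (auto simp: reals_Archimedean2)
      show "\<forall>a\<in>range (\<lambda>n::nat. ball (0::'a) (real n)). emeasure \<nu> a \<noteq> \<infinity>"
        by (auto simp: ball emeasure_ball)
    qed
  qed
  interpret P: pair_sigma_finite lborel \<nu> ..
  interpret P': pair_sigma_finite \<nu> lborel ..
  have "emeasure \<nu> A = emeasure lborel A" if [measurable]: "A \<in> sets borel" for A
  proof -
    define B where "B = ball (0::'a) 1"
    have [measurable]: "B \<in> sets borel" by (simp add: B_def)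
    have "emeasure \<nu> A * emeasure lborel B
        = (\<integral>\<^sup>+y. (\<integral>\<^sup>+x. indicator A x \<partial>\<nu>) * indicator B y \<partial>lborel)"
      by (simp add: nn_integral_cmult_indicator)
    \<comment> \<open>Translation invariance enters twice: here for \<open>\<nu>\<close>, shifting
      by \<open>y\<close>, and after the first exchange of integrals for \<open>lborel\<close>,
      shifting by \<open>x\<close>.\<close>
    also have "\<dots> = (\<integral>\<^sup>+y. (\<integral>\<^sup>+x. indicator A x \<partial>(distr \<nu> borel (\<lambda>x. x + y))) * indicator B y \<partial>lborel)"
      by (simp only: dtrans)
    also have "\<dots> = (\<integral>\<^sup>+y. (\<integral>\<^sup>+x. indicator A (x + y) * indicator B y \<partial>\<nu>) \<partial>lborel)"
      by (subst nn_integral_distr) (simp_all add: nn_integral_multc)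
    also have "\<dots> = (\<integral>\<^sup>+x. (\<integral>\<^sup>+y. indicator A (x + y) * indicator B y \<partial>lborel) \<partial>\<nu>)"
      by (rule P'.Fubini') measurable
    also have "\<dots> = (\<integral>\<^sup>+x. (\<integral>\<^sup>+y. indicator A y * indicator B (y - x) \<partial>lborel) \<partial>\<nu>)"
    proof (rule nn_integral_cong)
      fix x :: 'a
      have "(\<integral>\<^sup>+y. indicator A y * indicator B (y - x) \<partial>lborel)
         = (\<integral>\<^sup>+y. indicator A y * indicator B (y - x) \<partial>(distr lborel borel ((+) x)))"
        by (simp only: lborel_distr_plus)
      also have "\<dots> = (\<integral>\<^sup>+y. indicator A (x + y) * indicator B y \<partial>lborel)"
        by (subst nn_integral_distr) auto
      finally show "(\<integral>\<^sup>+y. indicator A (x + y) * indicator B y \<partial>lborel)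
        = (\<integral>\<^sup>+y. indicator A y * indicator B (y - x) \<partial>lborel)" by simp
    qed
    also have "\<dots> = (\<integral>\<^sup>+y. (\<integral>\<^sup>+x. indicator A y * indicator B (y - x) \<partial>\<nu>) \<partial>lborel)"
      by (rule P.Fubini') measurable
    also have "\<dots> = (\<integral>\<^sup>+y. indicator A y * emeasure lborel B \<partial>lborel)"
    proof (rule nn_integral_cong)
      fix y :: 'a
      have "(\<integral>\<^sup>+x. indicator A y * indicator B (y - x) \<partial>\<nu>)
         = indicator A y * (\<integral>\<^sup>+x. indicator {x. y - x \<in> B} x \<partial>\<nu>)"
        by (subst nn_integral_cmult[symmetric]) (auto simp: indicator_def intro!: nn_integral_cong)
      also have "\<dots> = indicator A y * emeasure \<nu> {x. y - x \<in> B}"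
        by (subst nn_integral_indicator) auto
      also note balls[folded B_def]
      finally show "(\<integral>\<^sup>+x. indicator A y * indicator B (y - x) \<partial>\<nu>) = indicator A y * emeasure lborel B" .
    qed
    also have "\<dots> = emeasure lborel A * emeasure lborel B"
      by (simp add: nn_integral_multc)
    finally show ?thesis
      using unit_ball_vol_pos[of "real DIM('a)"] by (auto simp add: B_def emeasure_ball mult_right_ennreal_cancel simp del: unit_ball_vol_pos)
  qed
  then show ?thesis unfolding \<nu>_def[symmetric] by (intro measure_eqI) auto
qed

lemma distr_lborel_orthogonal_shift:
  fixes f :: "'a::euclidean_space \<Rightarrow> 'a"
  assumes f: "orthogonal_transformation f"
  shows "distr lborel borel (\<lambda>x. c + f x) = lborel"
proof -
  have [measurable]: "f \<in> borel_measurable borel"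
    using f by (intro borel_measurable_continuous_onI linear_continuous_on linear_linear[THEN iffD2]
        orthogonal_transformation_linear)
  have "distr (distr lborel borel f) borel ((+) c) = distr lborel borel (\<lambda>x. c + f x)"
    by (subst distr_distr) (auto simp: o_def)
  then show ?thesis by (simp add: distr_lborel_orthogonal[OF f] lborel_distr_plus)
qed

lemma integral_minus_lborel:
  fixes g :: "'a::euclidean_space \<Rightarrow> real"
  assumes [measurable]: "g \<in> borel_measurable borel"
  shows "(\<integral>y. g (c - y) \<partial>lborel) = (\<integral>y. g y \<partial>lborel)"
    and "integrable lborel (\<lambda>y. g (c - y)) \<longleftrightarrow> integrable lborel g"
proof -
  have *: "distr lborel borel (\<lambda>y::'a. c + - y) = lborel"
    by (rule distr_lborel_orthogonal_shift) (simp add: orthogonal_transformation linear_iff)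
  have "(\<integral>y. g y \<partial>distr lborel borel (\<lambda>y. c + - y)) = (\<integral>y. g (c + - y) \<partial>lborel)"
    by (subst integral_distr) auto
  then show "(\<integral>y. g (c - y) \<partial>lborel) = (\<integral>y. g y \<partial>lborel)" by (simp only: *) simp
  have "integrable (distr lborel borel (\<lambda>y. c + - y)) g \<longleftrightarrow> integrable lborel (\<lambda>y. g (c + - y))"
    by (subst integrable_distr_eq) auto
  then show "integrable lborel (\<lambda>y. g (c - y)) \<longleftrightarrow> integrable lborel g" by (simp only: *) simp
qed

lemma integral_plus_lborel:
  fixes g :: "'a::euclidean_space \<Rightarrow> real"
  assumes [measurable]: "g \<in> borel_measurable borel"
  shows "(\<integral>y. g (c + y) \<partial>lborel) = (\<integral>y. g y \<partial>lborel)"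
    and "integrable lborel (\<lambda>y. g (c + y)) \<longleftrightarrow> integrable lborel g"
proof -
  have "(\<integral>y. g y \<partial>distr lborel borel ((+) c)) = (\<integral>y. g (c + y) \<partial>lborel)"
    by (subst integral_distr) auto
  then show "(\<integral>y. g (c + y) \<partial>lborel) = (\<integral>y. g y \<partial>lborel)" by (simp add: lborel_distr_plus)
  have "integrable (distr lborel borel ((+) c)) g \<longleftrightarrow> integrable lborel (\<lambda>y. g (c + y))"
    by (subst integrable_distr_eq) auto
  then show "integrable lborel (\<lambda>y. g (c + y)) \<longleftrightarrow> integrable lborel g" by (simp add: lborel_distr_plus)
qed

subsection \<open>Reflections in hyperplanes\<close>

text \<open>A reflection only when \<open>e\<close> is a unit vector; the lemmas carry
  \<open>norm e = 1\<close> where that matters.\<close>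

definition hrefl :: "'a::euclidean_space \<Rightarrow> real \<Rightarrow> 'a \<Rightarrow> 'a" where
  "hrefl e l x = x + (2 * (l - x \<bullet> e)) *\<^sub>R e"

lemma continuous_on_hrefl [continuous_intros]:
  "continuous_on A f \<Longrightarrow> continuous_on A (\<lambda>x. hrefl e l (f x))"
  unfolding hrefl_def by (intro continuous_intros)

lemma measurable_hrefl [measurable]: "hrefl e l \<in> borel_measurable borel"
  using continuous_on_hrefl[of UNIV "\<lambda>x. x"] by (intro borel_measurable_continuous_onI) auto

lemma hrefl_inner: "norm e = 1 \<Longrightarrow> hrefl e l x \<bullet> e = 2 * l - x \<bullet> e"
  by (simp add: hrefl_def inner_add_left dot_square_norm algebra_simps)

lemma hrefl_hrefl: "norm e = 1 \<Longrightarrow> hrefl e l (hrefl e l x) = x"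
  by (subst hrefl_def, subst hrefl_inner) (simp_all add: hrefl_def algebra_simps flip: scaleR_add_left)

text \<open>The source of every kernel comparison below: the extra term is four times the product of
  the signed distances to the hyperplane, so for two points on the same side, reflecting one of them
  increases their distance.\<close>

lemma norm_hrefl_diff_sq:
  assumes "norm e = 1"
  shows "(norm (x - hrefl e l y))\<^sup>2 = (norm (x - y))\<^sup>2 + 4 * ((l - x \<bullet> e) * (l - y \<bullet> e))"
proof -
  have e: "e \<bullet> e = 1" using assms by (simp add: dot_square_norm)
  have "(norm (x - hrefl e l y))\<^sup>2 = ((x - y) - (2 * (l - y \<bullet> e)) *\<^sub>R e) \<bullet> ((x - y) - (2 * (l - y \<bullet> e)) *\<^sub>R e)"
    by (simp add: hrefl_def power2_norm_eq_inner algebra_simps)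
  also have "\<dots> = (x - y) \<bullet> (x - y) - 4 * (l - y \<bullet> e) * ((x - y) \<bullet> e) + 4 * (l - y \<bullet> e)\<^sup>2"
    by (simp only: inner_diff_left[of "x - y"] inner_diff_right[of _ "x - y"] inner_scaleR_left
        inner_scaleR_right e inner_commute[of e "x - y"])
       (simp add: power2_eq_square algebra_simps)
  also have "\<dots> = (norm (x - y))\<^sup>2 + 4 * ((l - x \<bullet> e) * (l - y \<bullet> e))"
    unfolding power2_norm_eq_inner inner_diff_left[of x y e]
    unfolding power2_eq_square by algebra
  finally show ?thesis .
qed

lemma norm_diff_hrefl_commute:
  assumes "norm e = 1"
  shows "norm (hrefl e l x - y) = norm (x - hrefl e l y)"
proof -
  have "(norm (hrefl e l x - y))\<^sup>2 = (norm (x - hrefl e l y))\<^sup>2"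
    using norm_hrefl_diff_sq[OF assms, of x l y] norm_hrefl_diff_sq[OF assms, of y l x]
    by (simp only: norm_minus_commute mult.commute)
  then show ?thesis by simp
qed

lemma norm_hrefl_diff_hrefl: "norm e = 1 \<Longrightarrow> norm (hrefl e l x - hrefl e l y) = norm (x - y)"
  by (simp add: norm_diff_hrefl_commute hrefl_hrefl)

lemma norm_diff_le_hrefl:
  assumes "norm e = 1" "0 \<le> (l - x \<bullet> e) * (l - y \<bullet> e)"
  shows "norm (x - y) \<le> norm (x - hrefl e l y)"
  using norm_hrefl_diff_sq[OF assms(1), of x l y] assms(2)
  by (intro power2_le_imp_le[of "norm (x - y)"]) (linarith | simp)+

lemma norm_diff_less_hrefl:
  assumes "norm e = 1" "0 < (l - x \<bullet> e) * (l - y \<bullet> e)"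
  shows "norm (x - y) < norm (x - hrefl e l y)"
  using norm_hrefl_diff_sq[OF assms(1), of x l y] assms(2)
  by (intro power2_less_imp_less[of "norm (x - y)"]) (linarith | simp)+

text \<open>The reflection is the orthogonal map \<open>hrefl e 0\<close> followed by the shift by
  \<open>2 * l\<close> along \<open>e\<close>.\<close>

lemma distr_lborel_hrefl:
  assumes "norm e = 1"
  shows "distr lborel borel (hrefl e l) = (lborel :: 'a::euclidean_space measure)"
proof -
  have "orthogonal_transformation (hrefl e 0)"
    unfolding orthogonal_transformation
  proof
    show "linear (hrefl e 0)"
      by (auto simp: linear_iff hrefl_def inner_add_left algebra_simps)
    show "\<forall>v. norm (hrefl e 0 v) = norm v"
      using norm_hrefl_diff_hrefl[OF assms, of 0 _ 0] by (auto simp: hrefl_def)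
  qed
  from distr_lborel_orthogonal_shift[OF this, of "(2 * l) *\<^sub>R e"] show ?thesis
    by (simp add: hrefl_def[abs_def] algebra_simps)
qed

lemma integral_hrefl_lborel:
  fixes g :: "'a::euclidean_space \<Rightarrow> real"
  assumes "norm e = 1" and [measurable]: "g \<in> borel_measurable borel"
  shows "(\<integral>y. g (hrefl e l y) \<partial>lborel) = (\<integral>y. g y \<partial>lborel)"
    and "integrable lborel (\<lambda>y. g (hrefl e l y)) \<longleftrightarrow> integrable lborel g"
proof -
  note * = distr_lborel_hrefl[OF assms(1), of l]
  have "(\<integral>y. g y \<partial>distr lborel borel (hrefl e l)) = (\<integral>y. g (hrefl e l y) \<partial>lborel)"
    by (subst integral_distr) auto
  then show "(\<integral>y. g (hrefl e l y) \<partial>lborel) = (\<integral>y. g y \<partial>lborel)" by (simp add: *)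
  have "integrable (distr lborel borel (hrefl e l)) g \<longleftrightarrow> integrable lborel (\<lambda>y. g (hrefl e l y))"
    by (subst integrable_distr_eq) auto
  then show "integrable lborel (\<lambda>y. g (hrefl e l y)) \<longleftrightarrow> integrable lborel g" by (simp add: *)
qed

subsection \<open>Radial power kernels\<close>

text \<open>At the origin the kernel has the value \<open>0\<close>, because
  \<open>0 powr s = 0\<close> and division by zero yields \<open>0\<close>. Monotonicity in the norm
  therefore needs a nonzero argument.\<close>

definition rker :: "real \<Rightarrow> 'a::euclidean_space \<Rightarrow> real" where
  "rker s z = 1 / norm z powr s"

lemma rker_nonneg [simp]: "0 \<le> rker s z"
  by (simp add: rker_def)

lemma measurable_rker [measurable]: "rker s \<in> borel_measurable borel"
  unfolding rker_def by measurable

lemma rker_minus: "rker s (- z) = rker s z"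
  by (simp add: rker_def)

lemma rker_antimono:
  assumes "0 \<le> s" "0 < r" "r \<le> norm z"
  shows "rker s z \<le> 1 / r powr s"
proof -
  have "z \<noteq> 0" using assms by auto
  then show ?thesis
    unfolding rker_def using assms by (intro divide_left_mono powr_mono2) (auto simp: zero_less_mult_iff)
qed

lemma rker_mono_norm:
  assumes "0 \<le> s" "z \<noteq> 0" "norm z \<le> norm w"
  shows "rker s w \<le> rker s z"
  using rker_antimono[of s "norm z" w] assms by (simp add: rker_def)

text \<open>Off the null set \<open>{0}\<close>, \<open>f\<close> is dominated by the sum of
  \<open>c k\<close> times the indicator of \<open>ball 0 (r k)\<close>, and the integrals of these
  terms form a geometric series. Shrinking radii treat a singularity at the origin, growing radii
  the decay at infinity.\<close>

lemma integrable_dyadic: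
  fixes f :: "'a::euclidean_space \<Rightarrow> real"
  assumes [measurable]: "f \<in> borel_measurable borel"
    and nonneg: "\<And>z. 0 \<le> f z" and c: "\<And>k. 0 \<le> c k" and r: "\<And>k. 0 \<le> r k"
    and dom: "\<And>z. f z \<noteq> 0 \<Longrightarrow> z \<noteq> 0 \<Longrightarrow> \<exists>k. f z \<le> c k \<and> norm z < r k"
    and geom: "\<And>k. c k * r k ^ DIM('a) = C * \<rho> ^ k" and \<rho>: "0 \<le> \<rho>" "\<rho> < 1"
  shows "integrable lborel f"
proof (rule integrableI_nonneg)
  have C: "0 \<le> C" using mult_nonneg_nonneg[OF c[of 0] zero_le_power[OF r[of 0]], of "DIM('a)"] geom[of 0] by simp
  let ?s = "\<lambda>z::'a. \<Sum>k. ennreal (c k) * indicator (ball 0 (r k)) z"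
  have "AE z in lborel. z \<noteq> (0::'a)" by (rule AE_lborel_singleton)
  then have "(\<integral>\<^sup>+z. ennreal (f z) \<partial>lborel) \<le> (\<integral>\<^sup>+z. ?s z \<partial>lborel)"
  proof (intro nn_integral_mono_AE, eventually_elim)
    fix z :: 'a assume "z \<noteq> 0"
    show "ennreal (f z) \<le> ?s z"
    proof (cases "f z = 0")
      case False
      then obtain k where k: "f z \<le> c k" "norm z < r k" using dom \<open>z \<noteq> 0\<close> by blast
      have "ennreal (f z) \<le> (\<Sum>k\<in>{k}. ennreal (c k) * indicator (ball 0 (r k)) z)"
        using k by (simp add: ennreal_leI)
      also have "\<dots> \<le> ?s z" by (rule sum_le_suminf) auto
      finally show ?thesis .
    qed simp
  qed
  also have "\<dots> = (\<Sum>k. (\<integral>\<^sup>+z. ennreal (c k) * indicator (ball 0 (r k)) (z::'a) \<partial>lborel))"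
    by (intro nn_integral_suminf borel_measurable_times_ennreal borel_measurable_const borel_measurable_indicator) simp
  also have "\<dots> = (\<Sum>k. ennreal (unit_ball_vol DIM('a) * C * \<rho> ^ k))"
  proof (rule suminf_cong)
    fix k
    have "(\<integral>\<^sup>+z. ennreal (c k) * indicator (ball 0 (r k)) (z::'a) \<partial>lborel)
        = ennreal (c k) * ennreal (unit_ball_vol DIM('a) * r k ^ DIM('a))"
      using r[of k] by (simp add: nn_integral_cmult_indicator emeasure_ball)
    also have "\<dots> = ennreal (unit_ball_vol DIM('a) * (c k * r k ^ DIM('a)))"
      using c[of k] r[of k] by (subst ennreal_mult[symmetric]) (auto simp: mult_ac)
    finally show "(\<integral>\<^sup>+z. ennreal (c k) * indicator (ball 0 (r k)) (z::'a) \<partial>lborel)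
        = ennreal (unit_ball_vol DIM('a) * C * \<rho> ^ k)" by (simp add: geom mult.assoc)
  qed
  also have "\<dots> = ennreal (\<Sum>k. unit_ball_vol DIM('a) * C * \<rho> ^ k)"
    using \<rho> C by (intro suminf_ennreal2 summable_mult summable_geometric) auto
  also have "\<dots> < \<infinity>" by simp
  finally show "(\<integral>\<^sup>+z. ennreal (f z) \<partial>lborel) < \<infinity>" .
qed (use nonneg in auto)

lemma integrable_rker_ball:
  fixes s :: real
  assumes "0 \<le> s" "s < DIM('a)"
  shows "integrable lborel (\<lambda>z::'a::euclidean_space. indicator (ball 0 1) z * rker s z)"
\<comment> \<open>On the shell between radii \<open>(1/2) ^ Suc k\<close> and
  \<open>(1/2) ^ k\<close> the kernel is at most its value at the inner radius. The ratio
  \<open>\<rho>\<close> is \<open>2\<close> to the power \<open>s - DIM('a)\<close>, below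
  \<open>1\<close> because \<open>s < DIM('a)\<close>.\<close>
proof (rule integrable_dyadic[where c = "\<lambda>k. 1 / ((1/2) ^ Suc k) powr s" and r = "\<lambda>k. (1/2) ^ k"
      and C = "1 / (1/2) powr s" and \<rho> = "(1/2) ^ DIM('a) / (1/2) powr s"])
  fix k :: nat
  have "((1/2::real) ^ k) powr s = ((1/2) powr s) ^ k"
    by (simp add: powr_realpow[symmetric] powr_powr mult.commute)
  then have "((1/2) ^ Suc k) powr s = (1/2) powr s * ((1/2) powr s) ^ k"
    by (simp only: power_Suc) (subst powr_mult, auto)
  then show "1 / ((1/2) ^ Suc k) powr s * ((1/2) ^ k) ^ DIM('a)
     = 1 / (1/2) powr s * ((1/2) ^ DIM('a) / (1/2) powr s) ^ k"
    by (simp add: power_divide power_mult[symmetric] power_mult_distrib mult.commute)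
next
  have "(1/2) powr real DIM('a) < (1/2::real) powr s"
    using assms by (simp add: powr_divide field_simps)
  then show "(1/2) ^ DIM('a) / (1/2) powr s < (1::real)"
    by (simp add: powr_realpow)
next
  fix z :: 'a assume nz: "indicator (ball 0 1) z * rker s z \<noteq> 0" and "z \<noteq> 0"
  then have z: "norm z < 1" "0 < norm z" by (auto simp: indicator_def split: if_splits)
  obtain n where "(1/2) ^ n < norm z" using z(2) real_arch_pow_inv[of "norm z" "1/2"] by auto
  moreover have "(1/2) ^ Suc n \<le> (1/2::real) ^ n" by simp
  ultimately have ex: "\<exists>n. (1/2) ^ Suc n \<le> norm z" by (metis less_imp_le order.trans)
  define k where "k = (LEAST n. (1/2) ^ Suc n \<le> norm z)"
  have k: "(1/2) ^ Suc k \<le> norm z" unfolding k_def by (rule LeastI_ex[OF ex])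
  have "norm z < (1/2) ^ k"
  proof (cases k)
    case (Suc m)
    then show ?thesis using not_less_Least[of m "\<lambda>n. (1/2) ^ Suc n \<le> norm z"] by (auto simp: k_def not_le)
  qed (use z in auto)
  moreover have "indicator (ball 0 1) z * rker s z \<le> 1 / ((1/2) ^ Suc k) powr s"
    using rker_antimono[OF assms(1) _ k] z by simp
  ultimately show "\<exists>k. indicator (ball 0 1) z * rker s z \<le> 1 / ((1/2) ^ Suc k) powr s \<and> norm z < (1/2) ^ k"
    by blast
qed (auto intro!: borel_measurable_times borel_measurable_indicator measurable_rker)

lemma integrable_rker_compl_unit_ball:
  fixes s :: real
  assumes "s > DIM('a)"
  shows "integrable lborel (\<lambda>z::'a::euclidean_space. indicator (- ball 0 1) z * rker s z)"
\<comment> \<open>The same shells outwards, from radius \<open>2 ^ k\<close> to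
  \<open>2 ^ Suc k\<close>; now \<open>\<rho>\<close> is \<open>2\<close> to the power
  \<open>DIM('a) - s\<close>.\<close>
proof (rule integrable_dyadic[where c = "\<lambda>k. 1 / (2 ^ k) powr s" and r = "\<lambda>k. 2 ^ Suc k"
      and C = "2 ^ DIM('a)" and \<rho> = "2 ^ DIM('a) / 2 powr s"])
  fix k :: nat
  have "(2 ^ k) powr s = (2 powr s) ^ k"
    by (simp add: powr_realpow[symmetric] powr_powr mult.commute)
  then show "1 / (2 ^ k) powr s * (2 ^ Suc k) ^ DIM('a) = 2 ^ DIM('a) * (2 ^ DIM('a) / 2 powr s) ^ k"
    by (simp add: power_divide power_mult[symmetric] power_mult_distrib mult.commute)
next
  have "2 powr real DIM('a) < (2::real) powr s"
    using assms by simp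
  then show "2 ^ DIM('a) / 2 powr s < (1::real)"
    by (simp add: powr_realpow)
next
  fix z :: 'a assume nz: "indicator (- ball 0 1) z * rker s z \<noteq> 0"
  then have z: "1 \<le> norm z" by (auto simp: indicator_def split: if_splits)
  obtain n where "norm z < 2 ^ n" using real_arch_pow[of 2 "norm z"] by auto
  moreover have "(2::real) ^ n \<le> 2 ^ Suc n" by simp
  ultimately have ex: "\<exists>n. norm z < 2 ^ Suc n" by (metis less_le_trans)
  define k where "k = (LEAST n. norm z < 2 ^ Suc n)"
  have k: "norm z < 2 ^ Suc k" unfolding k_def by (rule LeastI_ex[OF ex])
  have "2 ^ k \<le> norm z"
  proof (cases k)
    case (Suc m)
    then show ?thesis using not_less_Least[of m "\<lambda>n. norm z < 2 ^ Suc n"] by (auto simp: k_def not_le)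
  qed (use z in auto)
  then have "indicator (- ball 0 1) z * rker s z \<le> 1 / (2 ^ k) powr s"
    using rker_antimono[of s "2 ^ k" z] z assms by simp
  with k show "\<exists>k. indicator (- ball 0 1) z * rker s z \<le> 1 / (2 ^ k) powr s \<and> norm z < 2 ^ Suc k"
    by blast
qed (auto intro!: borel_measurable_times borel_measurable_indicator measurable_rker)

lemma integrable_rker_compl_ball:
  fixes s :: real
  assumes "s > DIM('a)" "\<epsilon> > 0"
  shows "integrable lborel (\<lambda>z::'a::euclidean_space. indicator (- ball 0 \<epsilon>) z * rker s z)"
proof (rule Bochner_Integration.integrable_bound)
  have "integrable lborel (indicator (ball (0::'a) 1) :: 'a \<Rightarrow> real)"
    by (simp add: emeasure_ball)
  then show "integrable lborel (\<lambda>z::'a. 1 / \<epsilon> powr s * indicator (ball 0 1) z + indicator (- ball 0 1) z * rker s z)"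
    by (intro Bochner_Integration.integrable_add integrable_rker_compl_unit_ball assms integrable_mult_right)
  have "norm (indicator (- ball 0 \<epsilon>) z * rker s z)
      \<le> norm (1 / \<epsilon> powr s * indicator (ball 0 1) z + indicator (- ball 0 1) z * rker s z)" for z :: 'a
    using rker_antimono[of s \<epsilon> z] assms by (auto simp: indicator_def)
  then show "AE z in lborel. norm (indicator (- ball 0 \<epsilon>) z * rker s z)
      \<le> norm (1 / \<epsilon> powr s * indicator (ball 0 1) z + indicator (- ball 0 1) (z::'a) * rker s z)" by simp
qed (auto intro!: borel_measurable_times borel_measurable_indicator measurable_rker)

subsection \<open>The principal value integral\<close>

lemma C11_loc_continuous:
  assumes "C11_loc u"
  shows "continuous_on A u"
  using assms unfolding C11_loc_def gderiv_def
  by (metis continuous_at_imp_continuous_on has_derivative_continuous)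

text \<open>The mean value theorem for \<open>t \<mapsto> u (x + t z) + u (x - t z)\<close> produces
  a difference of gradients at two points \<open>2 t |z|\<close> apart. Restricting to
  \<open>norm z \<le> 1\<close> keeps them in \<open>cball x 1\<close>, where one Lipschitz constant
  serves.\<close>

lemma second_difference_bound:
  fixes u :: "'a::euclidean_space \<Rightarrow> real"
  assumes "C11_loc u"
  obtains L where "0 \<le> L" "\<And>z. norm z \<le> 1 \<Longrightarrow> \<bar>2 * u x - u (x + z) - u (x - z)\<bar> \<le> L * (norm z)\<^sup>2"
proof -
  obtain Du where Du: "\<And>y. (u has_derivative (\<lambda>h. h \<bullet> Du y)) (at y)"
    and "\<And>K. compact K \<Longrightarrow> \<exists>L. L-lipschitz_on K Du"
    using assms unfolding C11_loc_def gderiv_def by blast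
  then obtain L where L: "L-lipschitz_on (cball x 1) Du" by (meson compact_cball)
  have L0: "0 \<le> L" using L by (rule lipschitz_on_nonneg)
  show thesis
  proof (rule that[of "2 * L"])
    fix z :: 'a assume z: "norm z \<le> 1"
    define g where "g t = u (x + t *\<^sub>R z) + u (x - t *\<^sub>R z)" for t :: real
    have der: "(g has_real_derivative z \<bullet> Du (x + t *\<^sub>R z) - z \<bullet> Du (x - t *\<^sub>R z)) (at t)" for t
      unfolding g_def has_field_derivative_def
      by (rule has_derivative_eq_rhs, (rule derivative_intros has_derivative_compose[OF _ Du])+)
         (auto simp: fun_eq_iff algebra_simps)
    obtain t where t: "0 < t" "t < 1" "g 1 - g 0 = (1 - 0) * (z \<bullet> Du (x + t *\<^sub>R z) - z \<bullet> Du (x - t *\<^sub>R z))"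
      using MVT2[of 0 1 g "\<lambda>t. z \<bullet> Du (x + t *\<^sub>R z) - z \<bullet> Du (x - t *\<^sub>R z)"] der by auto
    have tz: "norm (t *\<^sub>R z) \<le> 1" using t z by (simp add: mult_le_one)
    have "\<bar>2 * u x - u (x + z) - u (x - z)\<bar> = \<bar>g 1 - g 0\<bar>" by (simp add: g_def)
    also have "\<dots> = \<bar>z \<bullet> (Du (x + t *\<^sub>R z) - Du (x - t *\<^sub>R z))\<bar>"
      using t by (simp add: inner_diff_right)
    also have "\<dots> \<le> norm z * norm (Du (x + t *\<^sub>R z) - Du (x - t *\<^sub>R z))"
      by (rule Cauchy_Schwarz_ineq2)
    also have "\<dots> \<le> norm z * (L * norm ((x + t *\<^sub>R z) - (x - t *\<^sub>R z)))"
      using lipschitz_onD[OF L, of "x + t *\<^sub>R z" "x - t *\<^sub>R z"] tz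
      by (intro mult_left_mono) (auto simp: dist_norm)
    also have "(x + t *\<^sub>R z) - (x - t *\<^sub>R z) = (2 * t) *\<^sub>R z"
      by (simp add: algebra_simps scaleR_2 flip: scaleR_scaleR)
    also have "norm z * (L * norm ((2 * t) *\<^sub>R z)) = t * (2 * L * (norm z)\<^sup>2)"
      using t by (simp add: power2_eq_square)
    also have "\<dots> \<le> 1 * (2 * L * (norm z)\<^sup>2)"
      using t L0 by (intro mult_right_mono) auto
    finally show "\<bar>2 * u x - u (x + z) - u (x - z)\<bar> \<le> 2 * L * (norm z)\<^sup>2" by simp
  qed (use L0 in simp)
qed

text \<open>The truncated integral without the normalizing constant, taken over
  \<open>lborel\<close> so that the substitution rules for translations and reflections
  apply.\<close>

definition frac_trunc :: "real \<Rightarrow> ('a::euclidean_space \<Rightarrow> real) \<Rightarrow> 'a \<Rightarrow> real \<Rightarrow> real" where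
  "frac_trunc \<alpha> u x \<epsilon> =
     (\<integral>y. indicator (- ball x \<epsilon>) y * ((u x - u y) * rker (real DIM('a) + \<alpha>) (x - y)) \<partial>lborel)"

lemma measurable_indicator_compl_ball [measurable]:
  "indicator (- ball (x::'a::euclidean_space) \<epsilon>) \<in> borel_measurable borel"
  "indicator (ball (x::'a::euclidean_space) \<epsilon>) \<in> borel_measurable borel"
  by (auto intro!: borel_measurable_indicator)

lemma frac_laplacian_eq:
  fixes u :: "'a::euclidean_space \<Rightarrow> real"
  assumes [measurable]: "u \<in> borel_measurable borel"
  shows "frac_laplacian \<alpha> u x = frac_laplacian_const DIM('a) \<alpha> * Lim (at_right 0) (frac_trunc \<alpha> u x)"
proof -
  have "(LINT y:(- ball x \<epsilon>)|lebesgue. (u x - u y) / norm (x - y) powr (real DIM('a) + \<alpha>))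
      = frac_trunc \<alpha> u x \<epsilon>" for \<epsilon>
    unfolding set_lebesgue_integral_def frac_trunc_def rker_def
    by (subst integral_completion) (auto intro!: borel_measurable_scaleR borel_measurable_indicator)
  then show ?thesis by (simp add: frac_laplacian_def)
qed

lemma integrable_bounded_rker:
  fixes h :: "'a::euclidean_space \<Rightarrow> real" and s :: real
  assumes [measurable]: "h \<in> borel_measurable borel" and M: "\<And>y. \<bar>h y\<bar> \<le> M"
    and "s > DIM('a)" "\<epsilon> > 0"
  shows "integrable lborel (\<lambda>y. indicator (- ball x \<epsilon>) y * (h y * rker s (x - y)))"
proof -
  let ?g = "\<lambda>z. indicator (- ball 0 \<epsilon>) z * (h (x - z) * rker s z)"
  have "integrable lborel ?g"
  proof (rule Bochner_Integration.integrable_bound)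
    show "integrable lborel (\<lambda>z::'a. M * (indicator (- ball 0 \<epsilon>) z * rker s z))"
      by (intro integrable_mult_right integrable_rker_compl_ball assms)
    have "norm (?g z) \<le> norm (M * (indicator (- ball 0 \<epsilon>) z * rker s z))" for z
    proof -
      have "\<bar>h (x - z)\<bar> \<le> \<bar>M\<bar>" using M[of "x - z"] by linarith
      then show ?thesis by (auto simp: indicator_def abs_mult intro: mult_right_mono)
    qed
    then show "AE z in lborel. norm (?g z) \<le> norm (M * (indicator (- ball 0 \<epsilon>) z * rker s z))" by simp
  qed measurable
  then have "integrable lborel (\<lambda>z. ?g (x - z))"
    by (subst integral_minus_lborel) auto
  also have "(\<lambda>z. ?g (x - z)) = (\<lambda>y. indicator (- ball x \<epsilon>) y * (h y * rker s (x - y)))"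
    by (auto simp: fun_eq_iff indicator_def dist_norm norm_minus_commute)
  finally show ?thesis .
qed

text \<open>Averaging the substitutions \<open>y = x + z\<close> and \<open>y = x - z\<close>
  cancels the first-order part of \<open>u\<close> and leaves a second difference, which is
  quadratic in \<open>z\<close> for a \<open>C11_loc\<close> function.\<close>

lemma frac_trunc_symmetrized:
  fixes u :: "'a::euclidean_space \<Rightarrow> real"
  assumes [measurable]: "u \<in> borel_measurable borel" and M: "\<And>y. \<bar>u y\<bar> \<le> M"
    and "\<alpha> > 0" "\<epsilon> > 0"
  shows "frac_trunc \<alpha> u x \<epsilon> = (\<integral>z. indicator (- ball 0 \<epsilon>) z *
     ((2 * u x - u (x + z) - u (x - z)) / 2 * rker (real DIM('a) + \<alpha>) z) \<partial>lborel)"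
proof -
  define g where "g y = indicator (- ball x \<epsilon>) y * ((u x - u y) * rker (real DIM('a) + \<alpha>) (x - y))" for y
  have [measurable]: "g \<in> borel_measurable borel" unfolding g_def by measurable
  have "\<bar>u x - u y\<bar> \<le> 2 * M" for y using M[of x] M[of y] by linarith
  then have int: "integrable lborel g"
    unfolding g_def using assms by (intro integrable_bounded_rker) auto
  have int': "integrable lborel (\<lambda>z. g (x + z))" "integrable lborel (\<lambda>z. g (x - z))"
    using int by (auto simp: integral_plus_lborel integral_minus_lborel)
  have "frac_trunc \<alpha> u x \<epsilon> = ((\<integral>z. g (x + z) \<partial>lborel) + (\<integral>z. g (x - z) \<partial>lborel)) / 2"
    using integral_plus_lborel(1)[of g x] integral_minus_lborel(1)[of g x]
    by (simp add: frac_trunc_def g_def[symmetric])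
  also have "\<dots> = (\<integral>z. (g (x + z) + g (x - z)) / 2 \<partial>lborel)"
    using int' by simp
  also have "\<dots> = (\<integral>z. indicator (- ball 0 \<epsilon>) z *
     ((2 * u x - u (x + z) - u (x - z)) / 2 * rker (real DIM('a) + \<alpha>) z) \<partial>lborel)"
    by (intro Bochner_Integration.integral_cong refl)
       (auto simp: g_def indicator_def dist_norm rker_minus field_simps)
  finally show ?thesis .
qed

text \<open>\<open>Lim\<close> carries information only once a limit is known to exist. Dominated
  convergence supplies it: near the origin the symmetrized integrand is bounded by a multiple of the
  kernel of exponent \<open>DIM('a) + \<alpha> - 2\<close>, integrable since
  \<open>\<alpha> < 2\<close>, and farther out by the bound on \<open>u\<close> times the integrable
  kernel.\<close>

lemma frac_trunc_convergent:
  fixes u :: "'a::euclidean_space \<Rightarrow> real"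
  assumes u: "C11_loc u" and M: "\<And>y. \<bar>u y\<bar> \<le> M"
    and "0 < \<alpha>" "\<alpha> < 2" "2 \<le> DIM('a)"
  shows "(frac_trunc \<alpha> u x \<longlongrightarrow> Lim (at_right 0) (frac_trunc \<alpha> u x)) (at_right 0)"
proof -
  have [measurable]: "u \<in> borel_measurable borel"
    using C11_loc_continuous[OF u] by (rule borel_measurable_continuous_onI)
  obtain L where L: "0 \<le> L" "\<And>z. norm z \<le> 1 \<Longrightarrow> \<bar>2 * u x - u (x + z) - u (x - z)\<bar> \<le> L * (norm z)\<^sup>2"
    using second_difference_bound[OF u] by blast
  let ?s = "real DIM('a) + \<alpha>"
  define G where "G z = (2 * u x - u (x + z) - u (x - z)) / 2 * rker ?s z" for z
  have [measurable]: "G \<in> borel_measurable borel" unfolding G_def by measurable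
  define w where "w z = L * (indicator (ball 0 1) z * rker (?s - 2) z)
      + 2 * M * (indicator (- ball 0 1) z * rker ?s z)" for z :: 'a
  have w: "integrable lborel w"
    unfolding w_def using assms
    by (intro Bochner_Integration.integrable_add integrable_mult_right integrable_rker_ball
        integrable_rker_compl_unit_ball) auto
  have M0: "0 \<le> M" using M[of 0] by linarith
  have Gw: "\<bar>G z\<bar> \<le> w z" for z
  proof (cases "norm z < 1")
    case True
    have r: "(norm z)\<^sup>2 * rker ?s z = rker (?s - 2) z"
    proof (cases "z = 0")
      case False
      then show ?thesis by (simp add: rker_def powr_diff)
    qed (simp add: rker_def)
    have "\<bar>G z\<bar> = \<bar>2 * u x - u (x + z) - u (x - z)\<bar> / 2 * rker ?s z"
      by (simp add: G_def abs_mult)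
    also have "\<dots> \<le> L * (norm z)\<^sup>2 * rker ?s z"
      using L(2)[of z] L(1) True by (intro mult_right_mono) auto
    also have "\<dots> = w z" using True r by (simp add: w_def mult.assoc)
    finally show ?thesis .
  next
    case False
    have "\<bar>2 * u x - u (x + z) - u (x - z)\<bar> \<le> 4 * M"
      using M[of x] M[of "x + z"] M[of "x - z"] by (simp only: abs_le_iff) linarith
    from mult_right_mono[OF this rker_nonneg[of ?s z]] show ?thesis using False
      by (simp add: G_def w_def abs_mult)
  qed
  \<comment> \<open>The convergence theorem used is stated for \<open>at_top\<close>, hence the
    truncation radius \<open>inverse t\<close>.\<close>
  have "((\<lambda>t. \<integral>z. indicator (- ball 0 (inverse t)) z * G z \<partial>lborel) \<longlongrightarrow> (\<integral>z. G z \<partial>lborel)) at_top"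
  proof (rule integral_dominated_convergence_at_top[where w = w])
    have "AE z in lborel. z \<noteq> (0::'a)" by (rule AE_lborel_singleton)
    then show "AE z in lborel. ((\<lambda>t. indicator (- ball 0 (inverse t)) z * G z) \<longlongrightarrow> G z) at_top"
    proof eventually_elim
      fix z :: 'a assume "z \<noteq> 0"
      have "eventually (\<lambda>t. inverse t < norm z) at_top"
        using order_tendstoD(2)[OF tendsto_inverse_0_at_top[OF filterlim_ident], of "norm z"] \<open>z \<noteq> 0\<close> by simp
      then have "eventually (\<lambda>t. indicator (- ball 0 (inverse t)) z * G z = G z) at_top"
        by eventually_elim auto
      then show "((\<lambda>t. indicator (- ball 0 (inverse t)) z * G z) \<longlongrightarrow> G z) at_top"
        by (rule tendsto_eventually)
    qed
    show "\<forall>\<^sub>F t in at_top. AE z in lborel. norm (indicator (- ball 0 (inverse t)) z * G z) \<le> w z"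
    proof (intro always_eventually allI AE_I2)
      fix t :: real and z :: 'a
      have "norm (indicator (- ball 0 (inverse t)) z * G z) \<le> \<bar>G z\<bar>" by (auto simp: indicator_def)
      with Gw[of z] show "norm (indicator (- ball 0 (inverse t)) z * G z) \<le> w z" by linarith
    qed
  qed (use w in measurable)
  then have "((\<lambda>\<epsilon>. \<integral>z. indicator (- ball 0 \<epsilon>) z * G z \<partial>lborel) \<longlongrightarrow> (\<integral>z. G z \<partial>lborel)) (at_right 0)"
    by (subst filterlim_at_right_to_top)
  moreover have "eventually (\<lambda>\<epsilon>. (\<integral>z. indicator (- ball 0 \<epsilon>) z * G z \<partial>lborel) = frac_trunc \<alpha> u x \<epsilon>) (at_right 0)"
    using eventually_at_right_less[of 0]
  proof eventually_elim
    case (elim \<epsilon>)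
    then show ?case unfolding G_def by (intro frac_trunc_symmetrized[symmetric] M) (use assms in auto)
  qed
  ultimately have "(frac_trunc \<alpha> u x \<longlongrightarrow> (\<integral>z. G z \<partial>lborel)) (at_right 0)"
    by (rule Lim_transform_eventually)
  then show ?thesis by (subst tendsto_Lim) auto
qed

section \<open>The fractional Laplacian at mirror points\<close>

lemma hrefl_symmetric_cases:
  assumes e: "norm e = 1"
    and sym: "\<And>y. P (hrefl e l y) \<Longrightarrow> P y" and half: "\<And>y. y \<bullet> e \<le> l \<Longrightarrow> P y"
  shows "P y"
proof (cases "y \<bullet> e \<le> l")
  case False
  then have "P (hrefl e l y)" by (intro half) (simp add: hrefl_inner e)
  then show ?thesis by (rule sym)
qed (rule half)

lemma integrable_indicator_ball [simp]:
  "integrable lborel (indicator (ball (x::'a::euclidean_space) r) :: 'a \<Rightarrow> real)"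
  by (cases "r \<ge> 0") (auto simp: emeasure_ball ball_empty)

lemma integral_indicator_ball:
  "r \<ge> 0 \<Longrightarrow> (\<integral>y. indicator (ball (x::'a::euclidean_space) r) y \<partial>lborel) = unit_ball_vol DIM('a) * r ^ DIM('a)"
  by (simp add: measure_def emeasure_ball)

text \<open>
  The difference of the truncated operators at \<open>x\<close> and its mirror image is the integral of
  \<open>g(y) = (U(x) - U(y)) |x - y|\<^sup>-\<^sup>s\<close>. Averaging \<open>g\<close> with its mirror image and using the antisymmetry
  of \<open>U\<close>, only the negative term \<open>2 U(x) |x - y|\<^sup>-\<^sup>s\<close> on the far side survives, up to the
  contribution of the reflected \<open>\<epsilon>\<close>-ball.
\<close>

lemma frac_trunc_reflection_le:
  fixes u :: "'a::euclidean_space \<Rightarrow> real" and \<alpha> :: real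
  assumes [measurable]: "u \<in> borel_measurable borel" and M: "\<And>y. \<bar>u y\<bar> \<le> M"
    and e: "norm e = 1" and \<alpha>: "\<alpha> > 0" and d: "d = l - x \<bullet> e" "0 < d" and \<epsilon>: "0 < \<epsilon>" "\<epsilon> \<le> d"
    and U: "\<And>y. U y = u (hrefl e l y) - u y"
    and min: "\<And>y. y \<bullet> e \<le> l \<Longrightarrow> U x \<le> U y" and "U x \<le> 0"
  shows "frac_trunc \<alpha> u (hrefl e l x) \<epsilon> - frac_trunc \<alpha> u x \<epsilon>
    \<le> 2 * U x * (unit_ball_vol DIM('a) * d ^ DIM('a) / (3 * d) powr (DIM('a) + \<alpha>))
       + 4 * M / d powr (DIM('a) + \<alpha>) * (unit_ball_vol DIM('a) * \<epsilon> ^ DIM('a))"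
proof -
  let ?R = "hrefl e l"
  define s where "s = real DIM('a) + \<alpha>"
  have s: "s > real DIM('a)" "0 \<le> s" using \<alpha> by (auto simp: s_def)
  have [measurable]: "U \<in> borel_measurable borel"
    unfolding U[abs_def] by measurable
  have M0: "0 \<le> M" using M[of 0] by linarith
  have U2: "\<bar>U y\<bar> \<le> 2 * M" for y using M[of "?R y"] M[of y] unfolding U by linarith
  have Usym: "U (?R y) = - U y" for y by (simp add: U hrefl_hrefl e)
  have ind: "indicator (- ball (?R x) \<epsilon>) (?R y) = (indicator (- ball x \<epsilon>) y :: real)" for y
    by (simp add: indicator_def dist_norm norm_hrefl_diff_hrefl e)
  have kr: "rker s (?R y - ?R z) = rker s (y - z)" for y z
    by (simp add: rker_def norm_hrefl_diff_hrefl e)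
  define g where "g y = indicator (- ball x \<epsilon>) y * ((U x - U y) * rker s (x - y))" for y
  have [measurable]: "g \<in> borel_measurable borel" unfolding g_def by measurable
  have "\<bar>U x - U y\<bar> \<le> 4 * M" for y using U2[of x] U2[of y] by linarith
  then have g: "integrable lborel g" unfolding g_def by (intro integrable_bounded_rker s \<epsilon>) auto
  have gR: "integrable lborel (\<lambda>y. g (?R y))" "(\<integral>y. g (?R y) \<partial>lborel) = (\<integral>y. g y \<partial>lborel)"
    using g by (auto simp: integral_hrefl_lborel e)
  \<comment> \<open>Substituting \<open>?R y\<close> for \<open>y\<close> moves the excised ball
    from \<open>?R x\<close> to \<open>x\<close>, so both truncated integrals run over the same set
    with the same kernel.\<close>
  have "frac_trunc \<alpha> u (?R x) \<epsilon>
      = (\<integral>y. indicator (- ball (?R x) \<epsilon>) (?R y) * ((u (?R x) - u (?R y)) * rker s (?R x - ?R y)) \<partial>lborel)"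
    unfolding frac_trunc_def s_def by (subst integral_hrefl_lborel(1)[OF e]) auto
  also have "\<dots> = (\<integral>y. indicator (- ball x \<epsilon>) y * ((u (?R x) - u (?R y)) * rker s (x - y)) \<partial>lborel)"
    by (simp add: ind kr)
  finally have "frac_trunc \<alpha> u (?R x) \<epsilon> - frac_trunc \<alpha> u x \<epsilon>
    = (\<integral>y. indicator (- ball x \<epsilon>) y * ((u (?R x) - u (?R y)) * rker s (x - y))
         - indicator (- ball x \<epsilon>) y * ((u x - u y) * rker s (x - y)) \<partial>lborel)"
  proof (simp only: frac_trunc_def s_def[symmetric], intro Bochner_Integration.integral_diff[symmetric])
    have "\<bar>u (?R x) - u (?R y)\<bar> \<le> 2 * M" "\<bar>u x - u y\<bar> \<le> 2 * M" for y
      using M[of "?R x"] M[of "?R y"] M[of x] M[of y] by linarith+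
    then show "integrable lborel (\<lambda>y. indicator (- ball x \<epsilon>) y * ((u (?R x) - u (?R y)) * rker s (x - y)))"
      "integrable lborel (\<lambda>y. indicator (- ball x \<epsilon>) y * ((u x - u y) * rker s (x - y)))"
      by (auto intro!: integrable_bounded_rker s \<epsilon>)
  qed
  also have "\<dots> = (\<integral>y. g y \<partial>lborel)"
    by (simp add: g_def U algebra_simps)
  also have "\<dots> = ((\<integral>y. g y \<partial>lborel) + (\<integral>y. g (?R y) \<partial>lborel)) / 2"
    by (simp add: gR)
  also have "\<dots> = (\<integral>y. (g y + g (?R y)) / 2 \<partial>lborel)"
    using g gR(1) by simp
  \<comment> \<open>Both sides are invariant under the reflection, so only \<open>y\<close> in the
    half-space needs checking. The first bracket retains the kernel on the ball of radius
    \<open>d\<close> about \<open>?R x\<close>. The second pays for \<open>y\<close> in the excised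
    ball, where \<open>g y = 0\<close> and \<open>g (?R y)\<close> has no partner to combine
    with.\<close>
  also have "\<dots> \<le> (\<integral>y. U x / (3 * d) powr s * (indicator (ball (?R x) d) y + indicator (ball (?R x) d) (?R y))
        + 2 * M / d powr s * (indicator (ball x \<epsilon>) y + indicator (ball x \<epsilon>) (?R y)) \<partial>lborel)"
  proof (rule integral_mono)
    show "integrable lborel (\<lambda>y. (g y + g (?R y)) / 2)" using g gR(1) by simp
    show "integrable lborel (\<lambda>y. U x / (3 * d) powr s * (indicator (ball (?R x) d) y + indicator (ball (?R x) d) (?R y))
        + 2 * M / d powr s * (indicator (ball x \<epsilon>) y + indicator (ball x \<epsilon>) (?R y)))"
      using e by (intro Bochner_Integration.integrable_add integrable_mult_right)
         (auto simp: integral_hrefl_lborel)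
    fix y
    show "(g y + g (?R y)) / 2 \<le> U x / (3 * d) powr s * (indicator (ball (?R x) d) y + indicator (ball (?R x) d) (?R y))
        + 2 * M / d powr s * (indicator (ball x \<epsilon>) y + indicator (ball x \<epsilon>) (?R y))"
      (is "?P y")
    proof (rule hrefl_symmetric_cases[OF e, where P = ?P and l = l])
      show "?P y" if "?P (?R y)" for y using that by (simp add: hrefl_hrefl e add.commute)
    next
      fix y assume y: "y \<bullet> e \<le> l"
      let ?k = "rker s (x - ?R y)"
      have xl: "x \<bullet> e = l - d" using d by simp
      have far: "d \<le> norm (x - ?R y)"
      proof -
        have "d \<le> (?R y - x) \<bullet> e" using y xl by (simp add: inner_diff_left hrefl_inner e)
        also have "\<dots> \<le> norm (?R y - x)" using norm_cauchy_schwarz[of "?R y - x" e] e by simp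
        finally show ?thesis by (simp add: norm_minus_commute)
      qed
      then have ir: "indicator (- ball x \<epsilon>) (?R y) = (1::real)" "indicator (ball x \<epsilon>) (?R y) = (0::real)"
        using \<epsilon> by (auto simp: dist_norm)
      have gRy: "g (?R y) = (U x + U y) * ?k"
        by (simp add: g_def ir Usym)
      have w: "indicator (ball (?R x) d) y = (0::real)"
      proof -
        have "d \<le> norm (?R x - y)" using far by (simp add: norm_diff_hrefl_commute e)
        then show ?thesis by (auto simp: dist_norm)
      qed
      have k1: "1 / (3 * d) powr s * indicator (ball (?R x) d) (?R y) \<le> ?k"
      proof (cases "?R y \<in> ball (?R x) d")
        case True
        then have "norm (?R x - ?R y) < d" by (simp add: dist_norm)
        moreover have "norm (x - ?R x) = 2 * d" using d e by (simp add: hrefl_def)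
        ultimately have "norm (x - ?R y) \<le> 3 * d"
          using norm_triangle_ineq[of "x - ?R x" "?R x - ?R y"] by simp
        moreover have "0 < norm (x - ?R y)" using far d by linarith
        ultimately have "norm (x - ?R y) powr s \<le> (3 * d) powr s" using s by (intro powr_mono2) auto
        then show ?thesis using True \<open>0 < norm (x - ?R y)\<close> d
          by (auto simp: rker_def intro!: divide_left_mono mult_pos_pos)
      qed simp
      have "U x * ?k \<le> U x * (1 / (3 * d) powr s * indicator (ball (?R x) d) (?R y))"
        using k1 \<open>U x \<le> 0\<close> by (rule mult_left_mono_neg)
      moreover have "(g y + g (?R y)) / 2 \<le> U x * ?k + 2 * M / d powr s * indicator (ball x \<epsilon>) y"
      proof (cases "y \<in> ball x \<epsilon>")
        case True
        have "?k \<le> 1 / d powr s" using rker_antimono[OF s(2) d(2) far] .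
        moreover have "(U y - U x) / 2 \<le> 2 * M" using abs_le_D2[OF U2[of x]] abs_le_D1[OF U2[of y]] by simp
        ultimately have "(U y - U x) / 2 * ?k \<le> 2 * M * (1 / d powr s)"
          using M0 by (intro mult_mono) auto
        moreover have "g y = 0" using True by (simp add: g_def)
        ultimately show ?thesis using True d(2) by (simp add: gRy field_simps)
      next
        case False
        then have "x \<noteq> y" using \<epsilon> by auto
        have "norm (x - y) \<le> norm (x - ?R y)"
          using y d by (intro norm_diff_le_hrefl e mult_nonneg_nonneg) auto
        then have "?k \<le> rker s (x - y)" using \<open>x \<noteq> y\<close> s by (intro rker_mono_norm) auto
        \<comment> \<open>Minimality makes \<open>U x - U y\<close> nonpositive, so passing to the
          smaller kernel \<open>?k\<close> increases the product. Added to
          \<open>g (?R y) = (U x + U y) * ?k\<close>, the terms in \<open>U y\<close> cancel and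
          \<open>2 * U x * ?k\<close> remains.\<close>
        then have "(U x - U y) * rker s (x - y) \<le> (U x - U y) * ?k"
          using min[OF y] by (intro mult_left_mono_neg) auto
        moreover have "g y = (U x - U y) * rker s (x - y)" using False by (simp add: g_def)
        ultimately show ?thesis using False by (simp add: gRy algebra_simps)
      qed
      ultimately have "(g y + g (?R y)) / 2
        \<le> U x * (1 / (3 * d) powr s * indicator (ball (?R x) d) (?R y)) + 2 * M / d powr s * indicator (ball x \<epsilon>) y"
        by linarith
      then show "?P y" by (simp add: w ir)
    qed
  qed
  also have "\<dots> = 2 * U x * (unit_ball_vol DIM('a) * d ^ DIM('a) / (3 * d) powr s)
       + 4 * M / d powr s * (unit_ball_vol DIM('a) * \<epsilon> ^ DIM('a))"
  proof -
    have i: "integrable lborel (\<lambda>y. indicator (ball z r) (?R y) :: real)"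
      "(\<integral>y. indicator (ball z r) (?R y) \<partial>lborel) = (\<integral>y. indicator (ball z r) y \<partial>lborel :: real)" for z :: 'a and r
      by (auto simp: integral_hrefl_lborel e)
    show ?thesis using \<epsilon> d
      by (simp add: i integral_indicator_ball measure_def emeasure_ball field_simps)
  qed
  finally show ?thesis by (simp add: s_def)
qed

text \<open>
  The factor \<open>3\<^sup>-\<^sup>(\<^sup>n\<^sup>+\<^sup>\<alpha>\<^sup>)\<close>: points within \<open>d\<close> of the mirror image of \<open>x\<close> lie within \<open>3 d\<close> of \<open>x\<close>.
\<close>

definition frac_gap :: "nat \<Rightarrow> real \<Rightarrow> real" where
  "frac_gap n \<alpha> = frac_laplacian_const n \<alpha> * (2 * unit_ball_vol n / 3 powr (n + \<alpha>))"

text \<open>The argument \<open>- \<alpha> / 2\<close> lies strictly between \<open>-1\<close> and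
  \<open>0\<close>, away from the poles, where \<open>Gamma\<close> would take the default value
  \<open>0\<close>.\<close>

lemma frac_laplacian_const_pos:
  assumes "0 < \<alpha>" "\<alpha> < 2"
  shows "0 < frac_laplacian_const n \<alpha>"
proof -
  have "- \<alpha> / 2 \<notin> \<int>\<^sub>\<le>\<^sub>0"
  proof
    assume "- \<alpha> / 2 \<in> \<int>\<^sub>\<le>\<^sub>0"
    then obtain k where "- \<alpha> / 2 = of_int k" "k \<le> 0" by (rule nonpos_Ints_cases)
    then have "- 1 < real_of_int k" "real_of_int k < 0" using assms by linarith+
    then have "- 1 < k" "k < 0" by linarith+
    then show False by linarith
  qed
  then have "Gamma (- \<alpha> / 2) \<noteq> 0" by (simp add: Gamma_eq_zero_iff)
  moreover have "0 < Gamma ((real n + \<alpha>) / 2)" using assms by (intro Gamma_real_pos) auto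
  ultimately show ?thesis by (simp add: frac_laplacian_const_def)
qed

lemma frac_gap_pos: "0 < \<alpha> \<Longrightarrow> \<alpha> < 2 \<Longrightarrow> 0 < frac_gap n \<alpha>"
  using frac_laplacian_const_pos[of \<alpha> n] by (simp add: frac_gap_def)

lemma riesz_const_pos: "0 < \<beta> \<Longrightarrow> \<beta> < real n \<Longrightarrow> 0 < riesz_const n \<beta>"
  by (simp add: riesz_const_def Gamma_real_pos)

text \<open>As \<open>\<epsilon>\<close> tends to \<open>0\<close> the error term of
  \<open>frac_trunc_reflection_le\<close> vanishes, and the powers of \<open>d\<close> combine to
  \<open>d powr (- \<alpha>)\<close>. For \<open>U x < 0\<close> the bound tends to minus infinity
  as \<open>x\<close> approaches the hyperplane; this rules out negative minima in thin
  strips.\<close>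

lemma frac_laplacian_reflection_le:
  fixes u :: "'a::euclidean_space \<Rightarrow> real"
  assumes u: "C11_loc u" and M: "\<And>y. \<bar>u y\<bar> \<le> M" and dim: "2 \<le> DIM('a)"
    and e: "norm e = 1" and \<alpha>: "0 < \<alpha>" "\<alpha> < 2" and x: "x \<bullet> e < l"
    and U: "\<And>y. U y = u (hrefl e l y) - u y"
    and min: "\<And>y. y \<bullet> e \<le> l \<Longrightarrow> U x \<le> U y" and "U x \<le> 0"
  shows "frac_laplacian \<alpha> u (hrefl e l x) - frac_laplacian \<alpha> u x
    \<le> frac_gap DIM('a) \<alpha> * U x / (l - x \<bullet> e) powr \<alpha>"
proof -
  have [measurable]: "u \<in> borel_measurable borel"
    using C11_loc_continuous[OF u] by (rule borel_measurable_continuous_onI)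
  define d where "d = l - x \<bullet> e"
  have d: "0 < d" using x by (simp add: d_def)
  let ?L = "\<lambda>x. Lim (at_right 0) (frac_trunc \<alpha> u x)"
  let ?A = "2 * U x * (unit_ball_vol DIM('a) * d ^ DIM('a) / (3 * d) powr (DIM('a) + \<alpha>))"
  let ?B = "4 * M / d powr (DIM('a) + \<alpha>)"
  have lim: "(frac_trunc \<alpha> u x \<longlongrightarrow> ?L x) (at_right 0)" for x
    by (rule frac_trunc_convergent[OF u M \<alpha> dim])
  have "?L (hrefl e l x) - ?L x \<le> ?A + ?B * (unit_ball_vol DIM('a) * 0 ^ DIM('a))"
  proof (rule tendsto_le[of "at_right (0::real)"])
    show "((\<lambda>\<epsilon>. frac_trunc \<alpha> u (hrefl e l x) \<epsilon> - frac_trunc \<alpha> u x \<epsilon>) \<longlongrightarrow> ?L (hrefl e l x) - ?L x) (at_right 0)"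
      by (intro tendsto_diff lim)
    show "((\<lambda>\<epsilon>. ?A + ?B * (unit_ball_vol DIM('a) * \<epsilon> ^ DIM('a)))
        \<longlongrightarrow> ?A + ?B * (unit_ball_vol DIM('a) * 0 ^ DIM('a))) (at_right 0)"
      by (intro tendsto_intros)
    have "eventually (\<lambda>\<epsilon>. 0 < \<epsilon> \<and> \<epsilon> < d) (at_right 0)"
      using eventually_at_right_real[OF d] by (auto elim: eventually_mono)
    then show "\<forall>\<^sub>F \<epsilon> in at_right 0. frac_trunc \<alpha> u (hrefl e l x) \<epsilon> - frac_trunc \<alpha> u x \<epsilon>
        \<le> ?A + ?B * (unit_ball_vol DIM('a) * \<epsilon> ^ DIM('a))"
      by eventually_elim (rule frac_trunc_reflection_le[OF _ M e \<alpha>(1) d_def d _ _ U min]; use assms in simp)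
  qed simp
  then have "?L (hrefl e l x) - ?L x \<le> ?A" by (simp add: power_0_left)
  also have "?A = 2 * unit_ball_vol DIM('a) / 3 powr (DIM('a) + \<alpha>) * U x / d powr \<alpha>"
    using d by (simp add: powr_mult powr_add powr_realpow field_simps)
  finally have "frac_laplacian_const DIM('a) \<alpha> * (?L (hrefl e l x) - ?L x)
    \<le> frac_laplacian_const DIM('a) \<alpha> * (2 * unit_ball_vol DIM('a) / 3 powr (DIM('a) + \<alpha>) * U x / d powr \<alpha>)"
    using frac_laplacian_const_pos[OF \<alpha>, of "DIM('a)"] by (intro mult_left_mono) auto
  then show ?thesis
    by (simp add: frac_laplacian_eq frac_gap_def d_def right_diff_distrib mult.assoc)
qed

subsection \<open>Riesz potentials and reflections\<close>

lemma riesz_potential_eq: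
  fixes f :: "'a::euclidean_space \<Rightarrow> real" and \<beta> :: real
  assumes [measurable]: "f \<in> borel_measurable borel"
  shows "riesz_potential \<beta> f x = riesz_const DIM('a) \<beta> * (\<integral>y. rker (DIM('a) - \<beta>) (x - y) * f y \<partial>lborel)"
  unfolding riesz_potential_def by (subst integral_completion) (auto simp: rker_def)

text \<open>Reflecting the variable of integration turns the difference of potentials into the
  integral of \<open>k (x - y) * h y\<close>. Since \<open>h\<close> is antisymmetric, averaging
  with the mirror image replaces the kernel by half of
  \<open>k (x - y) - k (x - hrefl e l y)\<close>, which has a sign on each side of the
  hyperplane.\<close>

lemma riesz_potential_reflection:
  fixes f :: "'a::euclidean_space \<Rightarrow> real" and \<beta> :: real
  defines "k \<equiv> rker (DIM('a) - \<beta>)"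
  assumes [measurable]: "f \<in> borel_measurable borel" and e: "norm e = 1"
    and int: "\<And>x. integrable lborel (\<lambda>y. k (x - y) * f y)"
    and h: "\<And>y. h y = f (hrefl e l y) - f y"
  shows "integrable lborel (\<lambda>y. (k (x - y) - k (x - hrefl e l y)) * h y)"
    and "riesz_potential \<beta> f (hrefl e l x) - riesz_potential \<beta> f x
      = riesz_const DIM('a) \<beta> / 2 * (\<integral>y. (k (x - y) - k (x - hrefl e l y)) * h y \<partial>lborel)"
proof -
  let ?R = "hrefl e l"
  have [measurable]: "k \<in> borel_measurable borel" by (simp add: k_def)
  have [measurable]: "h \<in> borel_measurable borel" unfolding h[abs_def] by measurable
  have hR: "h (?R y) = - h y" for y by (simp add: h hrefl_hrefl e)
  have kR: "k (?R x - y) = k (x - ?R y)" for y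
    by (simp add: k_def rker_def norm_diff_hrefl_commute e)
  have kRR: "k (?R x - ?R y) = k (x - y)" for y
    by (simp add: k_def rker_def norm_hrefl_diff_hrefl e)
  have i1: "integrable lborel (\<lambda>y. k (x - ?R y) * f y)"
    using int[of "?R x"] by (simp add: kR)
  have i2: "integrable lborel (\<lambda>y. k (x - y) * f (?R y))" "(\<integral>y. k (x - y) * f (?R y) \<partial>lborel) = (\<integral>y. k (?R x - y) * f y \<partial>lborel)"
    using integral_hrefl_lborel[OF e, of "\<lambda>y. k (?R x - y) * f y" l] int[of "?R x"] by (auto simp: kRR)
  have i3: "integrable lborel (\<lambda>y. k (x - ?R y) * f (?R y))"
    using integral_hrefl_lborel[OF e, of "\<lambda>y. k (x - y) * f y" l] int[of "x"] by auto
  have j1: "integrable lborel (\<lambda>y. k (x - y) * h y)"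
    using Bochner_Integration.integrable_diff[OF i2(1) int[of x]] by (simp add: h right_diff_distrib)
  have j2: "integrable lborel (\<lambda>y. k (x - ?R y) * h y)"
    using Bochner_Integration.integrable_diff[OF i3 i1] by (simp add: h right_diff_distrib)
  show "integrable lborel (\<lambda>y. (k (x - y) - k (x - ?R y)) * h y)"
    using Bochner_Integration.integrable_diff[OF j1 j2] by (simp add: left_diff_distrib)
  have "(\<integral>y. k (?R x - y) * f y \<partial>lborel) - (\<integral>y. k (x - y) * f y \<partial>lborel) = (\<integral>y. k (x - y) * h y \<partial>lborel)"
    using i2 int[of x] by (simp add: h right_diff_distrib)
  moreover have "(\<integral>y. k (x - ?R y) * h y \<partial>lborel) = - (\<integral>y. k (x - y) * h y \<partial>lborel)"
    using integral_hrefl_lborel(1)[OF e, of "\<lambda>y. k (x - y) * h y" l]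
    by (simp add: hR)
  moreover have "(\<integral>y. (k (x - y) - k (x - ?R y)) * h y \<partial>lborel)
    = (\<integral>y. k (x - y) * h y \<partial>lborel) - (\<integral>y. k (x - ?R y) * h y \<partial>lborel)"
    using Bochner_Integration.integral_diff[OF j1 j2] by (simp add: left_diff_distrib)
  ultimately show "riesz_potential \<beta> f (?R x) - riesz_potential \<beta> f x
      = riesz_const DIM('a) \<beta> / 2 * (\<integral>y. (k (x - y) - k (x - ?R y)) * h y \<partial>lborel)"
    by (simp add: riesz_potential_eq k_def[symmetric] flip: right_diff_distrib)
qed

lemma rker_hrefl_le:
  assumes "norm e = 1" "0 \<le> s" "x \<noteq> y" "x \<bullet> e \<le> l" "y \<bullet> e \<le> l"
  shows "rker s (x - hrefl e l y) \<le> rker s (x - y)"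
  using assms by (intro rker_mono_norm norm_diff_le_hrefl mult_nonneg_nonneg) auto

text \<open>\<open>W\<close> majorizes the negative part of \<open>h\<close> on the half-space,
  where the kernel difference lies between \<open>0\<close> and \<open>k (x - y)\<close>. The
  integrand is even under the reflection, so this half counts twice, which the factor
  \<open>1/2\<close> of the representation compensates.\<close>

lemma riesz_potential_reflection_ge:
  fixes f :: "'a::euclidean_space \<Rightarrow> real" and \<beta> :: real
  defines "k \<equiv> rker (DIM('a) - \<beta>)"
  assumes [measurable]: "f \<in> borel_measurable borel" and e: "norm e = 1" and \<beta>: "0 < \<beta>" "\<beta> < DIM('a)"
    and int: "\<And>x. integrable lborel (\<lambda>y. k (x - y) * f y)"
    and h: "\<And>y. h y = f (hrefl e l y) - f y"
    and x: "x \<bullet> e \<le> l" and [measurable]: "W \<in> borel_measurable borel" and W: "\<And>y. 0 \<le> W y"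
    and hW: "\<And>y. y \<bullet> e \<le> l \<Longrightarrow> - W y \<le> h y"
    and intW: "integrable lborel (\<lambda>y. k (x - y) * W y)"
  shows "riesz_potential \<beta> f (hrefl e l x) - riesz_potential \<beta> f x
      \<ge> - (riesz_const DIM('a) \<beta> * (\<integral>y. k (x - y) * W y \<partial>lborel))"
proof -
  let ?R = "hrefl e l"
  have [measurable]: "k \<in> borel_measurable borel" by (simp add: k_def)
  have [measurable]: "h \<in> borel_measurable borel" unfolding h[abs_def] by measurable
  note r = riesz_potential_reflection[where \<beta> = \<beta> and f = f, folded k_def, OF assms(2) e int h]
  have k0: "0 \<le> k z" for z by (simp add: k_def)
  let ?F = "\<lambda>y. (k (x - y) - k (x - ?R y)) * h y"
  let ?G = "\<lambda>y. k (x - y) * W y"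
  have G0: "0 \<le> ?G y" for y using k0 W by simp
  have GR: "integrable lborel (\<lambda>y. ?G (?R y))" "(\<integral>y. ?G (?R y) \<partial>lborel) = (\<integral>y. ?G y \<partial>lborel)"
    using integral_hrefl_lborel[OF e, of ?G l] intW by auto
  \<comment> \<open>The nonnegative term \<open>?G (?R y)\<close> is added to make the bound
    reflection invariant. The points \<open>x\<close> and \<open>?R x\<close> are excluded because
    the kernel has the value \<open>0\<close> at its singularity, which breaks the comparison
    there.\<close>
  have P: "y \<noteq> x \<longrightarrow> ?R y \<noteq> x \<longrightarrow> - (?G y + ?G (?R y)) \<le> ?F y" for y
  proof (rule hrefl_symmetric_cases[OF e, where l = l
        and P = "\<lambda>y. y \<noteq> x \<longrightarrow> ?R y \<noteq> x \<longrightarrow> - (?G y + ?G (?R y)) \<le> ?F y"])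
    fix y assume "?R y \<noteq> x \<longrightarrow> ?R (?R y) \<noteq> x \<longrightarrow> - (?G (?R y) + ?G (?R (?R y))) \<le> ?F (?R y)"
    then show "y \<noteq> x \<longrightarrow> ?R y \<noteq> x \<longrightarrow> - (?G y + ?G (?R y)) \<le> ?F y" by (simp add: hrefl_hrefl e h algebra_simps)
  next
    fix y assume y1: "y \<bullet> e \<le> l"
    show "y \<noteq> x \<longrightarrow> ?R y \<noteq> x \<longrightarrow> - (?G y + ?G (?R y)) \<le> ?F y"
    proof (intro impI)
      assume "y \<noteq> x"
      note y = y1 this
      have "0 \<le> k (x - y) - k (x - ?R y)"
        using rker_hrefl_le[OF e _ _ x y(1), of "DIM('a) - \<beta>"] \<beta> y(2) by (simp add: k_def)
      then have "(k (x - y) - k (x - ?R y)) * (- W y) \<le> ?F y"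
        using hW[OF y(1)] by (intro mult_left_mono) auto
      moreover have "- (k (x - y) * W y) \<le> (k (x - y) - k (x - ?R y)) * (- W y)"
        using k0[of "x - ?R y"] W[of y] by (simp add: algebra_simps)
      ultimately show "- (?G y + ?G (?R y)) \<le> ?F y" using G0[of "?R y"] by linarith
    qed
  qed
  have ae: "AE y in lborel. y \<noteq> x \<and> ?R y \<noteq> x"
  proof -
    have "AE y in lborel. y \<noteq> ?R x" "AE y in lborel. y \<noteq> x" by (rule AE_lborel_singleton)+
    then show ?thesis by eventually_elim (auto simp: hrefl_hrefl e)
  qed
  have "(\<integral>y. - (?G y + ?G (?R y)) \<partial>lborel) \<le> (\<integral>y. ?F y \<partial>lborel)"
  proof (intro integral_mono_AE Bochner_Integration.integrable_minus Bochner_Integration.integrable_add intW GR r)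
    show "AE y in lborel. - (?G y + ?G (?R y)) \<le> ?F y"
      using ae by eventually_elim (use P in blast)
  qed
  also have "(\<integral>y. - (?G y + ?G (?R y)) \<partial>lborel) = - (2 * (\<integral>y. ?G y \<partial>lborel))"
    using intW GR by simp
  finally have "riesz_const DIM('a) \<beta> / 2 * - (2 * (\<integral>y. ?G y \<partial>lborel)) \<le> riesz_const DIM('a) \<beta> / 2 * (\<integral>y. ?F y \<partial>lborel)"
    using riesz_const_pos[OF \<beta>] by (intro mult_left_mono) auto
  then show ?thesis unfolding r(2) by simp
qed

text \<open>The integrand is nonnegative almost everywhere. Were its integral zero, the open set of
  points \<open>y\<close> with \<open>y \<bullet> e < l\<close> and \<open>0 < h y\<close> would be
  null, the kernel difference being strictly positive there off \<open>x\<close>; a null open set is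
  empty, but this one contains \<open>y0\<close>.\<close>

lemma riesz_potential_reflection_pos:
  fixes f :: "'a::euclidean_space \<Rightarrow> real" and \<beta> :: real
  defines "k \<equiv> rker (DIM('a) - \<beta>)"
  assumes f: "continuous_on UNIV f" and e: "norm e = 1" and \<beta>: "0 < \<beta>" "\<beta> < DIM('a)"
    and int: "\<And>x. integrable lborel (\<lambda>y. k (x - y) * f y)"
    and x: "x \<bullet> e < l"
    and nonneg: "\<And>y. y \<bullet> e \<le> l \<Longrightarrow> f y \<le> f (hrefl e l y)"
    and y0: "y0 \<bullet> e < l" "f y0 < f (hrefl e l y0)"
  shows "riesz_potential \<beta> f x < riesz_potential \<beta> f (hrefl e l x)"
proof -
  let ?R = "hrefl e l"
  define h where "h y = f (?R y) - f y" for y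
  have fm[measurable]: "f \<in> borel_measurable borel" using f by (rule borel_measurable_continuous_onI)
  have [measurable]: "k \<in> borel_measurable borel" by (simp add: k_def)
  note r = riesz_potential_reflection[where \<beta> = \<beta> and f = f, folded k_def, OF fm e int h_def]
  let ?F = "\<lambda>y. (k (x - y) - k (x - ?R y)) * h y"
  have P: "y \<noteq> x \<longrightarrow> ?R y \<noteq> x \<longrightarrow> 0 \<le> ?F y" for y
  proof (rule hrefl_symmetric_cases[OF e, where l = l
        and P = "\<lambda>y. y \<noteq> x \<longrightarrow> ?R y \<noteq> x \<longrightarrow> 0 \<le> ?F y"])
    fix y assume "?R y \<noteq> x \<longrightarrow> ?R (?R y) \<noteq> x \<longrightarrow> 0 \<le> ?F (?R y)"
    then show "y \<noteq> x \<longrightarrow> ?R y \<noteq> x \<longrightarrow> 0 \<le> ?F y" by (simp add: hrefl_hrefl e h_def algebra_simps)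
  next
    fix y assume y1: "y \<bullet> e \<le> l"
    show "y \<noteq> x \<longrightarrow> ?R y \<noteq> x \<longrightarrow> 0 \<le> ?F y"
    proof (intro impI)
      assume "y \<noteq> x"
      note y = y1 this
      have "0 \<le> k (x - y) - k (x - ?R y)"
        using rker_hrefl_le[OF e _ _ _ y(1), of "DIM('a) - \<beta>" x] \<beta> x y(2) by (simp add: k_def)
      then show "0 \<le> ?F y" using nonneg[OF y(1)] by (simp add: h_def)
    qed
  qed
  have ae: "AE y in lborel. 0 \<le> ?F y"
  proof -
    have "AE y in lborel. y \<noteq> ?R x" "AE y in lborel. y \<noteq> x" by (rule AE_lborel_singleton)+
    then show ?thesis by eventually_elim (auto intro!: P[rule_format] simp: hrefl_hrefl e)
  qed
  have "(\<integral>y. ?F y \<partial>lborel) \<noteq> 0"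
  proof
    assume "(\<integral>y. ?F y \<partial>lborel) = 0"
    then have "AE y in lborel. ?F y = 0"
      using integral_nonneg_eq_0_iff_AE[OF r(1) ae] by simp
    moreover have "AE y in lborel. y \<noteq> x" by (rule AE_lborel_singleton)
    ultimately have "AE y in lborel. \<not> (y \<bullet> e < l \<and> 0 < h y)"
    proof eventually_elim
      fix y assume F: "?F y = 0" and "y \<noteq> x"
      show "\<not> (y \<bullet> e < l \<and> 0 < h y)"
      proof
        assume y: "y \<bullet> e < l \<and> 0 < h y"
        have "norm (x - y) < norm (x - ?R y)"
          using y x by (intro norm_diff_less_hrefl e) simp
        then have "norm (x - y) powr (DIM('a) - \<beta>) < norm (x - ?R y) powr (DIM('a) - \<beta>)"
          using \<beta> by (intro powr_less_mono2) auto
        then have "k (x - ?R y) < k (x - y)"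
          unfolding k_def rker_def using \<open>y \<noteq> x\<close> by (intro divide_strict_left_mono mult_pos_pos) auto
        then show False using F y by simp
      qed
    qed
    moreover have "open {y. y \<bullet> e < l \<and> 0 < h y}"
      unfolding h_def
      by (intro open_Collect_conj open_Collect_less continuous_intros continuous_on_compose2[OF f]) auto
    moreover from this have "{y. y \<bullet> e < l \<and> 0 < h y} \<in> sets lborel" by simp
    ultimately have "negligible {y. y \<bullet> e < l \<and> 0 < h y}"
      using AE_iff_null[of lborel "\<lambda>y. \<not> (y \<bullet> e < l \<and> 0 < h y)"]
      by (simp add: negligible_iff_null_sets null_sets_completionI)
    then have "{y. y \<bullet> e < l \<and> 0 < h y} = {}"
      using \<open>open {y. y \<bullet> e < l \<and> 0 < h y}\<close> open_not_negligible by blast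
    then show False using y0 by (auto simp: h_def)
  qed
  moreover have "0 \<le> (\<integral>y. ?F y \<partial>lborel)" using ae by (rule integral_nonneg_AE)
  ultimately have "0 < riesz_const DIM('a) \<beta> / 2 * (\<integral>y. ?F y \<partial>lborel)"
    using riesz_const_pos[OF \<beta>] by simp
  then show ?thesis using r(2)[of x] by simp
qed

section \<open>Uniform smallness of Riesz integrals over small sets\<close>

lemma rker_mult: "rker s z * rker t z = rker (s + t) z"
  by (simp add: rker_def powr_add)

lemma integrable_rker_translate:
  fixes s :: real and x :: "'a::euclidean_space"
  shows "0 \<le> s \<Longrightarrow> s < DIM('a) \<Longrightarrow> integrable lborel (\<lambda>y. indicator (ball 0 1) (x - y) * rker s (x - y))"
    and "(\<integral>y. indicator (ball 0 1) (x - y) * rker s (x - y) \<partial>lborel) = (\<integral>z. indicator (ball 0 1) (z::'a) * rker s z \<partial>lborel)"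
    and "s > DIM('a) \<Longrightarrow> integrable lborel (\<lambda>y. indicator (- ball 0 1) (x - y) * rker s (x - y))"
    and "(\<integral>y. indicator (- ball 0 1) (x - y) * rker s (x - y) \<partial>lborel) = (\<integral>z. indicator (- ball 0 1) (z::'a) * rker s z \<partial>lborel)"
  using integral_minus_lborel[of "\<lambda>z::'a. indicator (ball 0 1) z * rker s z" x]
    integral_minus_lborel[of "\<lambda>z::'a. indicator (- ball 0 1) z * rker s z" x]
    integrable_rker_ball[of s] integrable_rker_compl_unit_ball[of s] by auto

text \<open>Where \<open>norm (x - y) < 1\<close> the factor \<open>rker \<sigma> y\<close> is at
  most \<open>1\<close>. Elsewhere the factor at the longer of the vectors \<open>x - y\<close> and
  \<open>y\<close> is replaced by its value at the shorter one, and the exponents add. For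
  \<open>\<sigma> > \<beta>\<close> the integral of the right-hand side over \<open>y\<close> is
  finite and independent of \<open>x\<close>.\<close>

lemma rker_convolution_bound:
  fixes x y :: "'a::euclidean_space" and \<beta> :: real
  assumes "0 < \<beta>" "\<beta> < DIM('a)" "0 \<le> \<sigma>" "1 \<le> norm y"
  shows "rker (DIM('a) - \<beta>) (x - y) * rker \<sigma> y
    \<le> indicator (ball 0 1) (x - y) * rker (DIM('a) - \<beta>) (x - y)
     + indicator (- ball 0 1) (x - y) * rker (DIM('a) - \<beta> + \<sigma>) (x - y)
     + indicator (- ball 0 1) y * rker (DIM('a) - \<beta> + \<sigma>) y"
proof (cases "norm (x - y) < 1")
  case True
  have "rker \<sigma> y \<le> 1" using rker_antimono[of \<sigma> 1 y] assms by simp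
  then have "rker (DIM('a) - \<beta>) (x - y) * rker \<sigma> y \<le> rker (DIM('a) - \<beta>) (x - y)"
    by (simp add: mult_left_le)
  then show ?thesis using True by (simp add: add_increasing2)
next
  case False
  have "rker (DIM('a) - \<beta>) (x - y) * rker \<sigma> y \<le> rker (DIM('a) - \<beta> + \<sigma>) (x - y) + rker (DIM('a) - \<beta> + \<sigma>) y"
  proof (cases "norm (x - y) \<le> norm y")
    case True
    then have "rker \<sigma> y \<le> rker \<sigma> (x - y)" using assms False by (intro rker_mono_norm) auto
    then have "rker (DIM('a) - \<beta>) (x - y) * rker \<sigma> y \<le> rker (DIM('a) - \<beta>) (x - y) * rker \<sigma> (x - y)"
      by (intro mult_left_mono) auto
    also have "\<dots> = rker (DIM('a) - \<beta> + \<sigma>) (x - y)" by (rule rker_mult)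
    also have "\<dots> \<le> \<dots> + rker (DIM('a) - \<beta> + \<sigma>) y" by simp
    finally show ?thesis .
  next
    case le: False
    then have "rker (DIM('a) - \<beta>) (x - y) \<le> rker (DIM('a) - \<beta>) y"
      using assms False by (intro rker_mono_norm) auto
    then have "rker (DIM('a) - \<beta>) (x - y) * rker \<sigma> y \<le> rker (DIM('a) - \<beta>) y * rker \<sigma> y"
      by (intro mult_right_mono) auto
    also have "\<dots> = rker (DIM('a) - \<beta> + \<sigma>) y" by (rule rker_mult)
    also have "\<dots> \<le> rker (DIM('a) - \<beta> + \<sigma>) (x - y) + \<dots>" by simp
    finally show ?thesis .
  qed
  then show ?thesis using False assms by simp
qed

text \<open>The points \<open>y\<close> split into those with \<open>norm (x - y) < 1 / R\<close>,
  the remaining ones in \<open>ball 0 R\<close>, and the tail \<open>norm y \<ge> R\<close>. A large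
  \<open>R\<close> makes the first and last contributions small uniformly in \<open>x\<close>; then
  \<open>\<delta>\<close> is chosen to control the middle one, where the kernel is bounded.\<close>

lemma riesz_integral_uniformly_small:
  fixes w :: "'a::euclidean_space \<Rightarrow> real" and \<beta> \<sigma> :: real
  assumes [measurable]: "w \<in> borel_measurable borel" and \<beta>: "0 < \<beta>" "\<beta> < DIM('a)"
    and w0: "\<And>y. 0 \<le> w y" and wM: "\<And>y. w y \<le> M"
    and decay: "\<And>y. norm y \<ge> L \<Longrightarrow> w y \<le> C * rker \<sigma> y" and \<sigma>: "\<sigma> > \<beta>" and \<eta>: "0 < \<eta>"
  obtains R \<delta> where "R \<ge> L" "0 < \<delta>"
    "\<And>S x. S \<in> sets borel \<Longrightarrow> measure lborel (S \<inter> ball 0 R) \<le> \<delta> \<Longrightarrow>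
      integrable lborel (\<lambda>y. rker (DIM('a) - \<beta>) (x - y) * (indicator S y * w y)) \<and>
      (\<integral>y. rker (DIM('a) - \<beta>) (x - y) * (indicator S y * w y) \<partial>lborel) \<le> \<eta>"
proof -
  define n where "n = real DIM('a)"
  \<comment> \<open>The decay exponent is split: \<open>\<tau> > \<beta>\<close> still gives
    integrability at infinity, and the surplus \<open>\<sigma> - \<tau> > 0\<close> yields the
    factor \<open>R powr (- (\<sigma> - \<tau>))\<close> on the tail.\<close>
  define \<tau> where "\<tau> = (\<beta> + \<sigma>) / 2"
  have \<tau>: "\<beta> < \<tau>" "\<tau> < \<sigma>" using \<sigma> by (auto simp: \<tau>_def)
  have M0: "0 \<le> M" using w0[of 0] wM[of 0] by linarith
  define C' where "C' = max C 0"
  have C': "0 \<le> C'" "norm y \<ge> L \<Longrightarrow> w y \<le> C' * rker \<sigma> y" for y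
  proof -
    assume "norm y \<ge> L"
    then have "w y \<le> C * rker \<sigma> y" by (rule decay)
    also have "\<dots> \<le> C' * rker \<sigma> y" by (intro mult_right_mono) (auto simp: C'_def)
    finally show "w y \<le> C' * rker \<sigma> y" .
  qed (simp add: C'_def)
  \<comment> \<open>In the exponent \<open>n - \<beta> / 2\<close> half of the integrability margin
    at the singularity is given up, in exchange for the factor
    \<open>R powr (- (\<beta> / 2))\<close> where \<open>norm (x - y) < 1 / R\<close>.\<close>
  define A1 where "A1 = (\<integral>z. indicator (ball 0 1) (z::'a) * rker (n - \<beta> / 2) z \<partial>lborel)"
  define A2 where "A2 = (\<integral>z. indicator (ball 0 1) (z::'a) * rker (n - \<beta>) z \<partial>lborel)"
  define A3 where "A3 = (\<integral>z. indicator (- ball 0 1) (z::'a) * rker (n - \<beta> + \<tau>) z \<partial>lborel)"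
  have "((\<lambda>R::real. M * A1 * R powr (- (\<beta> / 2)) + C' * (A2 + 2 * A3) * R powr (- (\<sigma> - \<tau>)))
      \<longlongrightarrow> M * A1 * 0 + C' * (A2 + 2 * A3) * 0) at_top"
    using \<beta> \<tau> by (intro tendsto_intros tendsto_neg_powr filterlim_ident) auto
  then have "eventually (\<lambda>R::real. M * A1 * R powr (- (\<beta> / 2)) + C' * (A2 + 2 * A3) * R powr (- (\<sigma> - \<tau>)) < \<eta> / 2) at_top"
    using \<eta> by (intro order_tendstoD(2)) auto
  then have "eventually (\<lambda>R::real. M * A1 * R powr (- (\<beta> / 2)) + C' * (A2 + 2 * A3) * R powr (- (\<sigma> - \<tau>)) < \<eta> / 2
      \<and> R \<ge> L \<and> R \<ge> 1) at_top"
    by (intro eventually_conj eventually_ge_at_top)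
  then obtain R where R: "M * A1 * R powr (- (\<beta> / 2)) + C' * (A2 + 2 * A3) * R powr (- (\<sigma> - \<tau>)) < \<eta> / 2"
    "R \<ge> L" "R \<ge> 1"
    using eventually_happens'[OF trivial_limit_at_top_linorder] by blast
  \<comment> \<open>In the middle region the kernel is at most \<open>R powr (n - \<beta>)\<close>
    and \<open>w\<close> at most \<open>M\<close>; using \<open>M + 1\<close> keeps \<open>B\<close>
    positive for the division in \<open>\<delta>\<close>.\<close>
  define B where "B = (M + 1) * R powr (n - \<beta>)"
  have B: "0 < B" using M0 R by (simp add: B_def)
  show thesis
  proof (rule that[of R "\<eta> / (2 * B)"])
    fix S :: "'a set" and x :: 'a
    assume [measurable]: "S \<in> sets borel" and meas: "measure lborel (S \<inter> ball 0 R) \<le> \<eta> / (2 * B)"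
    let ?G = "\<lambda>y. rker (n - \<beta>) (x - y) * (indicator S y * w y)"
    let ?F1 = "\<lambda>y. indicator (ball 0 1) (x - y) * rker (n - \<beta> / 2) (x - y)"
    let ?F2 = "\<lambda>y. indicator (ball 0 1) (x - y) * rker (n - \<beta>) (x - y)
       + indicator (- ball 0 1) (x - y) * rker (n - \<beta> + \<tau>) (x - y)
       + indicator (- ball 0 1) y * rker (n - \<beta> + \<tau>) y"
    define F where "F y = M * R powr (- (\<beta> / 2)) * ?F1 y + B * indicator (S \<inter> ball 0 R) y
        + C' * R powr (- (\<sigma> - \<tau>)) * ?F2 y" for y
    have "emeasure lborel (S \<inter> ball 0 R) \<le> emeasure lborel (ball (0::'a) R)"
      by (rule emeasure_mono) auto
    also have "\<dots> < \<infinity>" using R by (simp add: emeasure_ball)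
    finally have fin: "emeasure lborel (S \<inter> ball 0 R) < \<infinity>" .
    have i1: "integrable lborel ?F1"
      using \<beta> by (simp add: integrable_rker_translate(1) n_def)
    have i2': "integrable lborel (\<lambda>y. indicator (ball 0 1) (x - y) * rker (n - \<beta>) (x - y))"
      "integrable lborel (\<lambda>y. indicator (- ball 0 1) (x - y) * rker (n - \<beta> + \<tau>) (x - y))"
      "integrable lborel (\<lambda>y::'a. indicator (- ball 0 1) y * rker (n - \<beta> + \<tau>) y)"
      using \<beta> \<tau> by (simp_all add: integrable_rker_translate(1,3) integrable_rker_compl_unit_ball n_def)
    then have i2: "integrable lborel ?F2"
      by (intro Bochner_Integration.integrable_add)
    have i0: "integrable lborel (indicator (S \<inter> ball 0 R) :: 'a \<Rightarrow> real)"
      using fin by simp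
    have F: "integrable lborel F"
      unfolding F_def by (intro Bochner_Integration.integrable_add integrable_mult_right i1 i2 i0)
    have "(\<integral>y. ?F2 y \<partial>lborel) = A2 + A3 + A3"
      unfolding A2_def A3_def using i2' by (simp add: integrable_rker_translate(2,4))
    then have "(\<integral>y. F y \<partial>lborel) = M * R powr (- (\<beta> / 2)) * A1 + B * measure lborel (S \<inter> ball 0 R)
        + C' * R powr (- (\<sigma> - \<tau>)) * (A2 + 2 * A3)"
      unfolding F_def using i0 i1 i2
      by (subst Bochner_Integration.integral_add; simp add: integrable_rker_translate(2) A1_def)
    also have "\<dots> \<le> \<eta>"
    proof -
      have "B * measure lborel (S \<inter> ball 0 R) \<le> \<eta> / 2"
        using mult_left_mono[OF meas, of B] B by simp
      then show ?thesis using R(1) by (simp add: mult_ac)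
    qed
    finally have Fle: "(\<integral>y. F y \<partial>lborel) \<le> \<eta>" .
    have G0: "0 \<le> ?G y" for y using w0 by simp
    have GF: "?G y \<le> F y" for y
    proof -
      have t: "0 \<le> M * R powr (- (\<beta> / 2)) * ?F1 y" "0 \<le> B * indicator (S \<inter> ball 0 R) y"
        "0 \<le> C' * R powr (- (\<sigma> - \<tau>)) * ?F2 y"
        using M0 B C' by (auto intro!: mult_nonneg_nonneg add_nonneg_nonneg)
      consider "y \<notin> S" | "norm (x - y) < 1 / R" | "y \<in> S" "1 / R \<le> norm (x - y)" "norm y < R" | "R \<le> norm y"
        by linarith
      then show ?thesis
      proof cases
        case 1
        then have "?G y = 0" by simp
        then show ?thesis using t unfolding F_def by linarith
      next
        case 2
        have b: "norm (x - y) < 1" using 2 R by (simp add: order_less_le_trans[of _ "1 / R"])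
        have "rker (n - \<beta>) (x - y) \<le> R powr (- (\<beta> / 2)) * rker (n - \<beta> / 2) (x - y)"
        proof (cases "x = y")
          case False
          have "rker (n - \<beta>) (x - y) = rker (- (\<beta> / 2)) (x - y) * rker (n - \<beta> / 2) (x - y)"
            by (simp add: rker_mult algebra_simps)
          moreover have "rker (- (\<beta> / 2)) (x - y) \<le> R powr (- (\<beta> / 2))"
          proof -
            have "rker (- (\<beta> / 2)) (x - y) = norm (x - y) powr (\<beta> / 2)"
              by (simp add: rker_def powr_minus_divide)
            also have "\<dots> \<le> (1 / R) powr (\<beta> / 2)" using 2 \<beta> by (intro powr_mono2) auto
            also have "\<dots> = R powr (- (\<beta> / 2))" using R by (simp add: powr_divide powr_minus_divide)
            finally show ?thesis .
          qed
          ultimately show ?thesis by (simp add: mult_right_mono)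
        qed (simp add: rker_def)
        moreover have "indicator S y * w y \<le> M" using M0 wM by (simp add: indicator_def)
        ultimately have "?G y \<le> R powr (- (\<beta> / 2)) * rker (n - \<beta> / 2) (x - y) * M"
          using w0 by (intro mult_mono) auto
        also have "\<dots> = M * R powr (- (\<beta> / 2)) * ?F1 y" using b by simp
        finally show ?thesis using t unfolding F_def by linarith
      next
        case 3
        have "rker (n - \<beta>) (x - y) \<le> 1 / (1 / R) powr (n - \<beta>)"
          using 3 \<beta> R by (intro rker_antimono) (auto simp: n_def)
        also have "\<dots> = R powr (n - \<beta>)" using R by (simp add: powr_divide)
        finally have "?G y \<le> R powr (n - \<beta>) * (M + 1)"
          using 3 w0 wM[of y] by (intro mult_mono) auto
        also have "\<dots> = B * indicator (S \<inter> ball 0 R) y" using 3 by (simp add: B_def)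
        finally show ?thesis using t unfolding F_def by linarith
      next
        case 4
        have "rker \<sigma> y = rker (\<sigma> - \<tau>) y * rker \<tau> y" by (simp add: rker_mult)
        also have "\<dots> \<le> 1 / R powr (\<sigma> - \<tau>) * rker \<tau> y"
          using 4 R \<tau> by (intro mult_right_mono rker_antimono) auto
        finally have "C' * rker \<sigma> y \<le> C' * (R powr (- (\<sigma> - \<tau>)) * rker \<tau> y)"
          using C'(1) by (intro mult_left_mono) (simp_all only: powr_minus_divide)
        moreover have "indicator S y * w y \<le> C' * rker \<sigma> y"
          using C'(2)[of y] C'(1) 4 R by (simp add: indicator_def)
        ultimately have "indicator S y * w y \<le> C' * (R powr (- (\<sigma> - \<tau>)) * rker \<tau> y)" by linarith
        then have "?G y \<le> rker (n - \<beta>) (x - y) * (C' * (R powr (- (\<sigma> - \<tau>)) * rker \<tau> y))"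
          by (intro mult_left_mono) auto
        also have "\<dots> = C' * R powr (- (\<sigma> - \<tau>)) * (rker (n - \<beta>) (x - y) * rker \<tau> y)" by simp
        also have "\<dots> \<le> C' * R powr (- (\<sigma> - \<tau>)) * ?F2 y"
          unfolding n_def using C'(1) 4 R \<beta> \<tau> by (intro mult_left_mono rker_convolution_bound) auto
        finally show ?thesis using t unfolding F_def by linarith
      qed
    qed
    have G: "integrable lborel ?G"
    proof (rule Bochner_Integration.integrable_bound[OF F])
      show "AE y in lborel. norm (?G y) \<le> norm (F y)"
      proof (rule AE_I2)
        fix y
        show "norm (?G y) \<le> norm (F y)" using G0[of y] GF[of y] by simp
      qed
    qed measurable
    moreover have "(\<integral>y. ?G y \<partial>lborel) \<le> (\<integral>y. F y \<partial>lborel)"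
      using G F GF by (rule integral_mono)
    ultimately show "integrable lborel (\<lambda>y. rker (DIM('a) - \<beta>) (x - y) * (indicator S y * w y)) \<and>
      (\<integral>y. rker (DIM('a) - \<beta>) (x - y) * (indicator S y * w y) \<partial>lborel) \<le> \<eta>"
      using Fle by (simp add: n_def)
  qed (use R B \<eta> in auto)
qed

subsection \<open>The maximum principle\<close>

text \<open>For \<open>r \<ge> 1\<close> this is the mean value theorem. For \<open>r < 1\<close>
  the derivative is largest at the smaller argument, so instead
  \<open>(s / t) powr r \<ge> s / t\<close> is used and gives the factor \<open>1\<close>. Either
  way the power is taken at the larger argument, which in the applications is the unreflected value
  of \<open>u\<close>.\<close>

lemma powr_diff_le_max:
  fixes r s t :: real
  assumes "0 < s" "s \<le> t" "0 < r"
  shows "t powr r - s powr r \<le> max 1 r * t powr (r - 1) * (t - s)"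
proof (cases "s = t")
  case False
  then have st: "s < t" using assms by simp
  show ?thesis
  proof (cases "r \<ge> 1")
    case True
    obtain z where z: "s < z" "z < t" "t powr r - s powr r = (t - s) * (r * z powr (r - 1))"
      using MVT2[OF st, of "\<lambda>x. x powr r" "\<lambda>x. r * x powr (r - 1)"] assms
      by (metis has_real_derivative_powr less_le_trans)
    have "z powr (r - 1) \<le> t powr (r - 1)" using z assms True by (intro powr_mono2) auto
    then have "(t - s) * (r * z powr (r - 1)) \<le> (t - s) * (r * t powr (r - 1))"
      using st True by (intro mult_left_mono) auto
    then show ?thesis using z True by (simp add: max_def mult_ac)
  next
    case False
    have "(s / t) powr 1 \<le> (s / t) powr r"
      using assms False by (intro powr_mono') auto
    then have "s / t * t powr r \<le> s powr r"
      using assms by (simp add: powr_divide field_simps)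
    moreover have "t powr r = t powr (r - 1) * t"
      using assms by (simp add: powr_diff)
    ultimately show ?thesis using False assms by (simp add: max_def field_simps)
  qed
qed simp

lemma continuous_bounded_above_at_infinity:
  fixes f :: "'a::euclidean_space \<Rightarrow> real"
  assumes f: "continuous_on UNIV f" and b: "eventually (\<lambda>x. f x \<le> b) at_infinity"
  obtains B where "\<And>x. f x \<le> B"
proof -
  obtain R where R: "\<And>x. norm x \<ge> R \<Longrightarrow> f x \<le> b" using b by (auto simp: eventually_at_infinity)
  have "bdd_above (f ` cball 0 R)"
    using f by (intro bounded_imp_bdd_above compact_imp_bounded compact_continuous_image)
      (auto intro: continuous_on_subset)
  then obtain c where c: "\<And>x. x \<in> cball 0 R \<Longrightarrow> f x \<le> c"
    unfolding bdd_above_def by (metis imageI)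
  have "f x \<le> max b c" for x
    using R[of x] c[of x] by (cases "norm x \<le> R") auto
  then show thesis by (rule that)
qed

text \<open>The data in the form that moving planes consumes. In the theorem \<open>\<sigma>\<close>
  becomes \<open>\<gamma> * (p - 1)\<close> and \<open>C\<close> becomes
  \<open>C2 powr (p - 1)\<close>.\<close>

locale hartree_system =
  fixes u v :: "'a::euclidean_space \<Rightarrow> real" and \<alpha> \<beta> p \<sigma> C R0 a :: real
  assumes dim: "2 \<le> DIM('a)"
    and \<alpha>: "0 < \<alpha>" "\<alpha> < 2" and \<beta>: "0 < \<beta>" "\<beta> < DIM('a)" and p: "1 < p"
    and u_C11: "C11_loc u" and v_cont: "continuous_on UNIV v"
    and v_eq: "\<And>x. v x = riesz_potential \<beta> (\<lambda>y. u y powr p) x"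
    and u_eq: "\<And>x. frac_laplacian \<alpha> u x + u x = v x * u x powr (p - 1)"
    and u_pos: "\<And>x. 0 < u x" and v_pos: "\<And>x. 0 < v x"
    and decay: "\<And>y. norm y \<ge> R0 \<Longrightarrow> u y powr (p - 1) \<le> C * rker \<sigma> y" and \<sigma>: "\<beta> < \<sigma>"
    and u_lim: "(u \<longlongrightarrow> 0) at_infinity"
    and ratio: "((\<lambda>x. u x powr (p - 2) * v x) \<longlongrightarrow> a) at_infinity" and a: "a * p < 1"
begin

abbreviation "k \<equiv> rker (real DIM('a) - \<beta>) :: 'a \<Rightarrow> real"

abbreviation "q \<equiv> max 1 (p - 1)"

lemma u_cont: "continuous_on A u"
  using u_C11 by (rule C11_loc_continuous)

lemma u_meas [measurable]: "u \<in> borel_measurable borel"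
  by (intro borel_measurable_continuous_onI u_cont)

lemma u_bounded: obtains M where "\<And>x. \<bar>u x\<bar> \<le> M"
proof -
  have "eventually (\<lambda>x. u x \<le> 1) at_infinity"
    using order_tendstoD(2)[OF u_lim, of 1] by (auto elim: eventually_mono)
  then obtain M where "\<And>x. u x \<le> M" by (rule continuous_bounded_above_at_infinity[OF u_cont]) (rule that)
  then have "\<bar>u x\<bar> \<le> M" for x using u_pos[of x] by simp
  then show thesis by (rule that)
qed

text \<open>A divergent potential would evaluate to \<open>0\<close>, against \<open>v > 0\<close>.\<close>

lemma potential_integrable: "integrable lborel (\<lambda>y. k (x - y) * u y powr p)"
proof (rule ccontr)
  assume "\<not> ?thesis"
  then have "v x = 0" by (simp add: v_eq riesz_potential_eq not_integrable_integral_eq)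
  then show False using v_pos[of x] by simp
qed

text \<open>The equations at the two mirror points are subtracted and the result is divided by the
  depth \<open>m\<close> of the minimum. Every term carries a factor \<open>m\<close>: the
  differences of powers of \<open>u\<close> are at most linear in the drop of \<open>u\<close>,
  which minimality bounds by \<open>m\<close>.\<close>

lemma negative_minimum_estimate:
  assumes e: "norm e = 1" and x: "x \<bullet> e < l"
    and min: "\<And>y. y \<bullet> e \<le> l \<Longrightarrow> u (hrefl e l x) - u x \<le> u (hrefl e l y) - u y"
    and neg: "u (hrefl e l x) < u x"
    and M1: "\<And>y. u y powr (p - 1) \<le> M1"
    and S: "S = {y. y \<bullet> e \<le> l \<and> u (hrefl e l y) < u y}"
    and int: "integrable lborel (\<lambda>y. k (x - y) * (indicator S y * u y powr (p - 1)))"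
  shows "1 + frac_gap DIM('a) \<alpha> / (l - x \<bullet> e) powr \<alpha>
    \<le> riesz_const DIM('a) \<beta> * p * M1 * (\<integral>y. k (x - y) * (indicator S y * u y powr (p - 1)) \<partial>lborel)
      + q * (u x powr (p - 2) * v x)"
proof -
  let ?R = "hrefl e l" and ?c = "riesz_const DIM('a) \<beta>"
  obtain M where M: "\<And>x. \<bar>u x\<bar> \<le> M" by (rule u_bounded) (rule that)
  define U where "U y = u (?R y) - u y" for y
  define m where "m = - U x"
  have m: "0 < m" using neg by (simp add: m_def U_def)
  have mU: "- U y \<le> m" if "y \<bullet> e \<le> l" for y using min[OF that] by (simp add: m_def U_def)
  let ?I = "\<integral>y. k (x - y) * (indicator S y * u y powr (p - 1)) \<partial>lborel"
  have I0: "0 \<le> ?I" by (intro integral_nonneg_AE AE_I2) simp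
  have c0: "0 < ?c" using \<beta> by (rule riesz_const_pos)
  have [measurable]: "S \<in> sets borel" unfolding S by measurable
  \<comment> \<open>On \<open>S\<close>, \<open>powr_diff_le_max\<close> with exponent
    \<open>p\<close> bounds the loss in \<open>u powr p\<close> by
    \<open>p * u y powr (p - 1)\<close> times a drop of at most \<open>m\<close>.\<close>
  define W where "W y = p * m * (indicator S y * u y powr (p - 1))" for y
  have kW: "(\<lambda>y. k (x - y) * W y) = (\<lambda>y. p * m * (k (x - y) * (indicator S y * u y powr (p - 1))))"
    by (auto simp: W_def)
  have V: "v (?R x) - v x \<ge> - (?c * (p * m * ?I))"
  proof -
    have "riesz_potential \<beta> (\<lambda>y. u y powr p) (?R x) - riesz_potential \<beta> (\<lambda>y. u y powr p) x
      \<ge> - (?c * (\<integral>y. k (x - y) * W y \<partial>lborel))"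
    proof (rule riesz_potential_reflection_ge[OF _ e \<beta> potential_integrable refl])
      show "- W y \<le> u (?R y) powr p - u y powr p" if y: "y \<bullet> e \<le> l" for y
      proof (cases "y \<in> S")
        case True
        then have lt: "u (?R y) < u y" by (simp add: S)
        have "u y powr p - u (?R y) powr p \<le> max 1 p * u y powr (p - 1) * (u y - u (?R y))"
          using lt u_pos p by (intro powr_diff_le_max) auto
        also have "\<dots> \<le> max 1 p * u y powr (p - 1) * m"
          using mU[OF y] p by (intro mult_left_mono) (auto simp: U_def)
        also have "\<dots> = W y" using True p by (simp add: W_def)
        finally show ?thesis by simp
      next
        case False
        then have "u y \<le> u (?R y)" using y by (simp add: S)
        then have "u y powr p \<le> u (?R y) powr p" using u_pos[of y] p by (intro powr_mono2) auto
        then show ?thesis using False by (simp add: W_def)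
      qed
      show "integrable lborel (\<lambda>y. k (x - y) * W y)" unfolding kW using int by simp
    qed (use x p m in \<open>auto simp: W_def\<close>)
    then show ?thesis by (simp add: v_eq[symmetric] kW)
  qed
  have L: "frac_laplacian \<alpha> u (?R x) - frac_laplacian \<alpha> u x \<le> frac_gap DIM('a) \<alpha> * U x / (l - x \<bullet> e) powr \<alpha>"
    by (rule frac_laplacian_reflection_le[OF u_C11 M dim e \<alpha> x])
       (use min neg in \<open>auto simp: U_def\<close>)
  have s: "u (?R x) powr (p - 1) \<le> M1" "0 \<le> u (?R x) powr (p - 1)" using M1 by auto
  have "(v (?R x) - v x) * u (?R x) powr (p - 1) \<ge> - (?c * (p * m * ?I)) * u (?R x) powr (p - 1)"
    using V s by (intro mult_right_mono)
  moreover have "?c * (p * m * ?I) * u (?R x) powr (p - 1) \<le> ?c * (p * m * ?I) * M1"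
    using c0 p m I0 s by (intro mult_left_mono) auto
  ultimately have 1: "(v (?R x) - v x) * u (?R x) powr (p - 1) \<ge> - (?c * (p * m * ?I) * M1)"
    by simp
  have "u x powr (p - 1) - u (?R x) powr (p - 1) \<le> q * u x powr (p - 1 - 1) * (u x - u (?R x))"
    using neg u_pos p by (intro powr_diff_le_max) auto
  then have "u x powr (p - 1) - u (?R x) powr (p - 1) \<le> q * u x powr (p - 2) * m"
    by (simp add: m_def U_def)
  then have 2: "v x * (u x powr (p - 1) - u (?R x) powr (p - 1)) \<le> v x * (q * u x powr (p - 2) * m)"
    using v_pos[of x] by (intro mult_left_mono) auto
  have L': "frac_laplacian \<alpha> u (?R x) - frac_laplacian \<alpha> u x
      \<le> - m * (frac_gap DIM('a) \<alpha> / (l - x \<bullet> e) powr \<alpha>)"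
    using L by (simp add: m_def mult.commute)
  \<comment> \<open>The product is split so that \<open>v\<close> in the second term stands at
    \<open>x\<close>; its coefficient is then \<open>u x powr (p - 2) * v x\<close>, the quantity
    whose limit is \<open>a\<close>.\<close>
  have "frac_laplacian \<alpha> u (?R x) - frac_laplacian \<alpha> u x - m
    = (v (?R x) - v x) * u (?R x) powr (p - 1) - v x * (u x powr (p - 1) - u (?R x) powr (p - 1))"
    using u_eq[of x] u_eq[of "?R x"] by (simp add: m_def U_def algebra_simps)
  with 1 2 L' have "- m * (frac_gap DIM('a) \<alpha> / (l - x \<bullet> e) powr \<alpha>) - m
    \<ge> - (?c * (p * m * ?I) * M1) - v x * (q * u x powr (p - 2) * m)"
    by linarith
  then have "m * (1 + frac_gap DIM('a) \<alpha> / (l - x \<bullet> e) powr \<alpha>)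
     \<le> m * (?c * p * M1 * ?I + q * (u x powr (p - 2) * v x))"
    by (simp add: algebra_simps)
  then show ?thesis using m by (rule mult_left_le_imp_le)
qed

text \<open>Since \<open>u\<close> is positive and tends to \<open>0\<close>, the difference
  \<open>U\<close> exceeds \<open>U x1\<close> outside a large ball, so minimizing over a compact
  piece suffices. The minimum is off the hyperplane because \<open>U\<close> vanishes there.\<close>

lemma negative_minimum_attained:
  assumes e: "norm e = 1" and x1: "x1 \<bullet> e \<le> l" "u (hrefl e l x1) < u x1"
  obtains x where "x \<bullet> e < l" "u (hrefl e l x) < u x"
    "\<And>y. y \<bullet> e \<le> l \<Longrightarrow> u (hrefl e l x) - u x \<le> u (hrefl e l y) - u y"
proof -
  define U where "U y = u (hrefl e l y) - u y" for y
  have "eventually (\<lambda>y. u y < - U x1) at_infinity"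
    using x1 by (intro order_tendstoD(2)[OF u_lim]) (simp add: U_def)
  then obtain R where R: "\<And>y. norm y \<ge> R \<Longrightarrow> u y < - U x1"
    by (auto simp: eventually_at_infinity)
  have out: "U x1 < U y" if "norm y \<ge> R" for y
    using R[OF that] u_pos[of "hrefl e l y"] by (simp add: U_def)
  define K where "K = {y. y \<bullet> e \<le> l} \<inter> cball 0 R"
  have K: "compact K" unfolding K_def
    by (intro closed_Int_compact compact_cball closed_Collect_le continuous_intros)
  have x1K: "x1 \<in> K" using x1 out[of x1] by (auto simp: K_def not_le intro: ccontr less_imp_le)
  have "continuous_on K U" unfolding U_def
    by (intro continuous_intros continuous_on_compose2[OF u_cont[of UNIV]]) auto
  then obtain x where x: "x \<in> K" "\<And>y. y \<in> K \<Longrightarrow> U x \<le> U y"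
    using continuous_attains_inf[OF K] x1K by blast
  have Ux: "U x \<le> U x1" using x x1K by blast
  have neg: "u (hrefl e l x) < u x" using Ux x1 by (simp add: U_def)
  show thesis
  proof (rule that[of x])
    have "x \<bullet> e \<noteq> l"
    proof
      assume "x \<bullet> e = l"
      then have "hrefl e l x = x" by (simp add: hrefl_def)
      then show False using neg by simp
    qed
    then show "x \<bullet> e < l" using x(1) by (simp add: K_def)
    show "u (hrefl e l x) - u x \<le> u (hrefl e l y) - u y" if "y \<bullet> e \<le> l" for y
    proof (cases "norm y \<le> R")
      case True
      then show ?thesis using x(2)[of y] that by (simp add: K_def U_def)
    next
      case False
      then show ?thesis using out[of y] Ux by (simp add: U_def)
    qed
  qed (rule neg)
qed

text \<open>Decay at infinity and the narrow region principle in one statement.\<close>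

lemma reflection_maximum_principle:
  "\<exists>R \<delta> d0. 0 < \<delta> \<and> 0 < d0 \<and> (\<forall>e l. norm e = 1 \<longrightarrow>
     measure lborel ({y. y \<bullet> e \<le> l \<and> u (hrefl e l y) < u y} \<inter> ball 0 R) \<le> \<delta> \<longrightarrow>
     (\<forall>y. y \<bullet> e \<le> l \<longrightarrow> u (hrefl e l y) < u y \<longrightarrow> norm y < R \<longrightarrow> l - y \<bullet> e < d0) \<longrightarrow>
     (\<forall>y. y \<bullet> e \<le> l \<longrightarrow> u y \<le> u (hrefl e l y)))"
proof -
  let ?c = "riesz_const DIM('a) \<beta>"
  have c0: "0 < ?c" using \<beta> by (rule riesz_const_pos)
  obtain M where M: "\<And>x. \<bar>u x\<bar> \<le> M" by (rule u_bounded) (rule that)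
  have uM: "u x \<le> M" for x using M[of x] by simp
  define M1 where "M1 = M powr (p - 1)"
  have M1: "u y powr (p - 1) \<le> M1" for y
    unfolding M1_def using uM[of y] u_pos[of y] p by (intro powr_mono2) auto
  have M1_pos: "0 < M1" using uM[of 0] u_pos[of 0] by (simp add: M1_def)
  \<comment> \<open>For \<open>a > 0\<close> this follows from \<open>a * p < 1\<close>, as
    \<open>q = max 1 (p - 1)\<close> is at most \<open>p\<close>.\<close>
  have qa: "q * a < 1"
  proof (cases "a \<le> 0")
    case True
    then have "q * a \<le> 0" by (intro mult_nonneg_nonpos) auto
    then show ?thesis by simp
  next
    case False
    have "a * q \<le> a * p" using p False by (intro mult_left_mono) auto
    then show ?thesis using a by (simp add: mult.commute)
  qed
  \<comment> \<open>At most half of the slack \<open>1 - q * a\<close>, so that the local term is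
    below \<open>1 - \<kappa>\<close> near infinity. The cap at \<open>1\<close> is for the
    contradiction inside the ball.\<close>
  define \<kappa> where "\<kappa> = min 1 ((1 - q * a) / 2)"
  have "\<kappa> \<le> (1 - q * a) / 2" unfolding \<kappa>_def by (rule min.cobounded2)
  with qa have \<kappa>: "0 < \<kappa>" "\<kappa> \<le> 1" "q * a < 1 - \<kappa>" by (auto simp: \<kappa>_def)
  have "((\<lambda>x. q * (u x powr (p - 2) * v x)) \<longlongrightarrow> q * a) at_infinity"
    by (intro tendsto_intros ratio)
  from order_tendstoD(2)[OF this \<kappa>(3)]
  have ev: "eventually (\<lambda>x. q * (u x powr (p - 2) * v x) < 1 - \<kappa>) at_infinity" .
  then obtain R1 where R1: "\<And>x. norm x \<ge> R1 \<Longrightarrow> q * (u x powr (p - 2) * v x) < 1 - \<kappa>"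
    by (auto simp: eventually_at_infinity)
  have "continuous_on UNIV (\<lambda>x. q * (u x powr (p - 2) * v x))"
    using u_pos by (intro continuous_intros u_cont v_cont) (auto simp: less_imp_neq[symmetric])
  then obtain B where B: "\<And>x. q * (u x powr (p - 2) * v x) \<le> B"
    by (rule continuous_bounded_above_at_infinity[of _ "1 - \<kappa>"]) (use ev in \<open>auto elim: eventually_mono\<close>)
  \<comment> \<open>Chosen so that the potential term contributes at most
    \<open>\<kappa> / 2\<close>.\<close>
  define \<eta> where "\<eta> = \<kappa> / (2 * (?c * p * M1))"
  have \<eta>: "0 < \<eta>" using \<kappa> c0 p M1_pos by (simp add: \<eta>_def)
  have c\<eta>: "?c * p * M1 * \<eta> = \<kappa> / 2" using c0 p M1_pos by (simp add: \<eta>_def)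
  obtain R \<delta> where R: "R \<ge> max R0 R1" and \<delta>: "0 < \<delta>"
    and small: "\<And>S x. S \<in> sets borel \<Longrightarrow> measure lborel (S \<inter> ball 0 R) \<le> \<delta> \<Longrightarrow>
      integrable lborel (\<lambda>y. k (x - y) * (indicator S y * u y powr (p - 1))) \<and>
      (\<integral>y. k (x - y) * (indicator S y * u y powr (p - 1)) \<partial>lborel) \<le> \<eta>"
  proof (rule riesz_integral_uniformly_small[where L = "max R0 R1" and C = C, OF _ \<beta> _ M1 _ \<sigma> \<eta>])
    show "u y powr (p - 1) \<le> C * rker \<sigma> y" if "norm y \<ge> max R0 R1" for y
      using decay[of y] that by simp
  qed (use that in auto)
  let ?g = "frac_gap DIM('a) \<alpha>"
  have g: "0 < ?g" using \<alpha> by (rule frac_gap_pos)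
  \<comment> \<open>Solves \<open>?g / d0 powr \<alpha> = \<bar>B\<bar> + 1\<close>: within this
    distance of the hyperplane the gain from the fractional Laplacian beats the bound
    \<open>B\<close> on the local term.\<close>
  define d0 where "d0 = (?g / (\<bar>B\<bar> + 1)) powr (1 / \<alpha>)"
  have d0: "0 < d0" "d0 powr \<alpha> = ?g / (\<bar>B\<bar> + 1)" using g \<alpha> by (auto simp: d0_def powr_powr)
  show ?thesis
  proof (rule exI[of _ R], rule exI[of _ \<delta>], rule exI[of _ d0], intro conjI allI impI)
    fix e l x1
    assume e: "norm e = 1"
      and meas: "measure lborel ({y. y \<bullet> e \<le> l \<and> u (hrefl e l y) < u y} \<inter> ball 0 R) \<le> \<delta>"
      and narrow: "\<forall>y. y \<bullet> e \<le> l \<longrightarrow> u (hrefl e l y) < u y \<longrightarrow> norm y < R \<longrightarrow> l - y \<bullet> e < d0"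
      and x1: "x1 \<bullet> e \<le> l"
    define S where "S = {y. y \<bullet> e \<le> l \<and> u (hrefl e l y) < u y}"
    have [measurable]: "S \<in> sets borel" unfolding S_def by measurable
    show "u x1 \<le> u (hrefl e l x1)"
    proof (rule ccontr)
      assume "\<not> ?thesis"
      with x1 have "x1 \<bullet> e \<le> l" "u (hrefl e l x1) < u x1" by auto
      then obtain x where x: "x \<bullet> e < l" "u (hrefl e l x) < u x"
        and min: "\<And>y. y \<bullet> e \<le> l \<Longrightarrow> u (hrefl e l x) - u x \<le> u (hrefl e l y) - u y"
        by (rule negative_minimum_attained[OF e]) blast
      note sm = small[OF \<open>S \<in> sets borel\<close> meas[folded S_def], of x]
      let ?I = "\<integral>y. k (x - y) * (indicator S y * u y powr (p - 1)) \<partial>lborel"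
      let ?d = "l - x \<bullet> e"
      have "1 + ?g / ?d powr \<alpha> \<le> ?c * p * M1 * ?I + q * (u x powr (p - 2) * v x)"
        by (rule negative_minimum_estimate[OF e x(1) min x(2) M1 S_def conjunct1[OF sm]])
      moreover have "?c * p * M1 * ?I \<le> ?c * p * M1 * \<eta>"
        using sm c0 p M1_pos by (intro mult_left_mono) auto
      ultimately have est: "1 + ?g / ?d powr \<alpha> \<le> \<kappa> / 2 + q * (u x powr (p - 2) * v x)"
        unfolding c\<eta> by linarith
      have g1: "0 \<le> ?g / ?d powr \<alpha>" using g by simp
      \<comment> \<open>Inside the ball the estimate would give
        \<open>2 + \<bar>B\<bar> \<le> \<kappa> / 2 + B\<close>, outside it
        \<open>1 < 1 - \<kappa> / 2\<close>.\<close>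
      show False
      proof (cases "norm x < R")
        case True
        have "?d < d0" using narrow True x by simp
        then have "?d powr \<alpha> \<le> d0 powr \<alpha>" using x \<alpha> by (intro powr_mono2) auto
        then have "?g / d0 powr \<alpha> \<le> ?g / ?d powr \<alpha>"
          using g x d0 by (intro divide_left_mono mult_pos_pos) auto
        moreover have "?g / d0 powr \<alpha> = \<bar>B\<bar> + 1" using g by (simp add: d0)
        ultimately show False using est B[of x] \<kappa> by linarith
      next
        case False
        then have "q * (u x powr (p - 2) * v x) < 1 - \<kappa>" using R by (intro R1) auto
        then show False using est g1 \<kappa> by linarith
      qed
    qed
  qed (use \<delta> d0 in auto)
qed

end

subsection \<open>Sliding the hyperplane\<close>

text \<open>Continuity from above: inside a ball the strips have finite measure and shrink to a part
  of a hyperplane, which is null.\<close>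

lemma strip_measure_small:
  fixes e :: "'a::euclidean_space"
  assumes "e \<noteq> 0" "0 < \<delta>"
  obtains t where "0 < t" "measure lborel ({y. \<bar>y \<bullet> e - l\<bar> \<le> t} \<inter> ball 0 R) \<le> \<delta>"
proof -
  define A where "A n = {y. \<bar>y \<bullet> e - l\<bar> \<le> 1 / real (Suc n)} \<inter> ball 0 R" for n
  have [measurable]: "A n \<in> sets borel" for n unfolding A_def by measurable
  have inter: "(\<Inter>n. A n) \<subseteq> {y. e \<bullet> y = l}"
  proof
    fix y assume "y \<in> (\<Inter>n. A n)"
    then have "\<bar>y \<bullet> e - l\<bar> \<le> 1 / real (Suc n)" for n by (auto simp: A_def)
    then have "\<bar>y \<bullet> e - l\<bar> \<le> 0"
      by (intro LIMSEQ_le_const[OF LIMSEQ_Suc[OF lim_1_over_n]]) auto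
    then show "y \<in> {y. e \<bullet> y = l}" by (simp add: inner_commute)
  qed
  have "emeasure lborel (A n) \<noteq> \<infinity>" for n
  proof -
    have "emeasure lborel (A n) \<le> emeasure lborel (ball (0::'a) R)"
      by (rule emeasure_mono) (auto simp: A_def)
    also have "\<dots> < \<infinity>" by (cases "R \<ge> 0") (auto simp: emeasure_ball ball_empty)
    finally show ?thesis by simp
  qed
  moreover have "decseq A"
    unfolding A_def by (intro decseq_SucI) (auto elim!: order_trans intro!: divide_left_mono)
  ultimately have "(\<lambda>n. measure lborel (A n)) \<longlonglongrightarrow> measure lborel (\<Inter>n. A n)"
    by (intro Lim_measure_decseq) auto
  also have "measure lborel (\<Inter>n. A n) = 0"
  proof -
    have "negligible (\<Inter>n. A n)"
      using assms inter by (intro negligible_subset[OF negligible_hyperplane[of e l]]) auto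
    then have "(\<Inter>n. A n) \<in> null_sets lborel"
      by (simp add: negligible_iff_null_sets null_sets_completion_iff)
    then show ?thesis by (auto simp: measure_def)
  qed
  finally have "eventually (\<lambda>n. measure lborel (A n) < \<delta>) sequentially"
    using assms(2) by (rule order_tendstoD(2))
  then obtain n where "measure lborel (A n) < \<delta>" by (auto simp: eventually_sequentially)
  then show thesis by (intro that[of "1 / real (Suc n)"]) (auto simp: A_def)
qed

context hartree_system
begin

text \<open>For \<open>l \<le> - R\<close> the half-space misses \<open>ball 0 R\<close>, so both
  conditions of \<open>reflection_maximum_principle\<close> hold trivially.\<close>

lemma reflection_start:
  assumes e: "norm e = 1"
  obtains l0 where "\<And>l y. l \<le> l0 \<Longrightarrow> y \<bullet> e \<le> l \<Longrightarrow> u y \<le> u (hrefl e l y)"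
proof -
  obtain R \<delta> d0 where \<delta>: "0 < \<delta>" "0 < d0"
    and mp: "\<forall>e l. norm e = 1 \<longrightarrow>
     measure lborel ({y. y \<bullet> e \<le> l \<and> u (hrefl e l y) < u y} \<inter> ball 0 R) \<le> \<delta> \<longrightarrow>
     (\<forall>y. y \<bullet> e \<le> l \<longrightarrow> u (hrefl e l y) < u y \<longrightarrow> norm y < R \<longrightarrow> l - y \<bullet> e < d0) \<longrightarrow>
     (\<forall>y. y \<bullet> e \<le> l \<longrightarrow> u y \<le> u (hrefl e l y))"
    using reflection_maximum_principle by blast
  show thesis
  proof (rule that[of "- R"])
    fix l y assume l: "l \<le> - R" and y: "y \<bullet> e \<le> l"
    define S where "S = {y. y \<bullet> e \<le> l \<and> u (hrefl e l y) < u y}"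
    have far: "R \<le> norm y" if "y \<in> S" for y
      using that l norm_cauchy_schwarz[of "- y" e] e by (simp add: S_def)
    then have "S \<inter> ball 0 R = {}" by fastforce
    then have "measure lborel (S \<inter> ball 0 R) \<le> \<delta>" using \<delta> by simp
    moreover have "\<forall>y. y \<bullet> e \<le> l \<longrightarrow> u (hrefl e l y) < u y \<longrightarrow> norm y < R \<longrightarrow> l - y \<bullet> e < d0"
      using far by (force simp: S_def)
    ultimately show "u y \<le> u (hrefl e l y)" using mp e y unfolding S_def by blast
  qed
qed

text \<open>A strong maximum principle. At a point of equality the difference
  \<open>u \<circ> R - u\<close> has a zero minimum, so its fractional Laplacian is nonpositive and
  the equation gives \<open>v (hrefl e l x) \<le> v x\<close>; strict inequality at
  \<open>y0\<close> forces the opposite strict inequality through the Riesz potential.\<close>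

lemma reflection_strict:
  assumes e: "norm e = 1"
    and nonneg: "\<And>y. y \<bullet> e \<le> l \<Longrightarrow> u y \<le> u (hrefl e l y)"
    and y0: "y0 \<bullet> e < l" "u y0 < u (hrefl e l y0)" and x: "x \<bullet> e < l"
  shows "u x < u (hrefl e l x)"
proof (rule ccontr)
  assume "\<not> ?thesis"
  then have eq: "u (hrefl e l x) = u x" using nonneg[of x] x by simp
  obtain M where M: "\<And>x. \<bar>u x\<bar> \<le> M" by (rule u_bounded) (rule that)
  have "frac_laplacian \<alpha> u (hrefl e l x) - frac_laplacian \<alpha> u x
    \<le> frac_gap DIM('a) \<alpha> * (u (hrefl e l x) - u x) / (l - x \<bullet> e) powr \<alpha>"
    by (rule frac_laplacian_reflection_le[OF u_C11 M dim e \<alpha> x]) (use eq nonneg in auto)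
  then have "v (hrefl e l x) * u x powr (p - 1) \<le> v x * u x powr (p - 1)"
    using u_eq[of x] u_eq[of "hrefl e l x"] eq by simp
  then have "v (hrefl e l x) \<le> v x" using u_pos[of x] by simp
  moreover have "v x < v (hrefl e l x)"
    unfolding v_eq
  proof (rule riesz_potential_reflection_pos[OF _ e \<beta> potential_integrable x _ y0(1)])
    show "continuous_on UNIV (\<lambda>y. u y powr p)"
      using u_pos by (intro continuous_intros u_cont) (auto simp: less_imp_neq[symmetric])
    show "u y powr p \<le> u (hrefl e l y) powr p" if "y \<bullet> e \<le> l" for y
      using nonneg[OF that] u_pos[of y] p by (intro powr_mono2) auto
    show "u y0 powr p < u (hrefl e l y0) powr p"
      using y0 u_pos[of y0] p by (intro powr_less_mono2) auto
  qed
  ultimately show False by simp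
qed

text \<open>On the compact part of the half-space at distance at least \<open>t\<close> from the
  hyperplane the difference has a positive lower bound, and uniform continuity keeps it positive for
  nearby levels \<open>m\<close>. Inside the ball the bad set is thus confined to a thin strip,
  where \<open>reflection_maximum_principle\<close> applies.\<close>

lemma reflection_extend:
  assumes e: "norm e = 1"
    and strict: "\<And>y. y \<bullet> e < l \<Longrightarrow> u y < u (hrefl e l y)"
  obtains \<tau> where "0 < \<tau>" "\<And>m y. l \<le> m \<Longrightarrow> m \<le> l + \<tau> \<Longrightarrow> y \<bullet> e \<le> m \<Longrightarrow> u y \<le> u (hrefl e m y)"
proof -
  obtain R \<delta> d0 where \<delta>: "0 < \<delta>" "0 < d0"
    and mp: "\<forall>e l. norm e = 1 \<longrightarrow>
     measure lborel ({y. y \<bullet> e \<le> l \<and> u (hrefl e l y) < u y} \<inter> ball 0 R) \<le> \<delta> \<longrightarrow>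
     (\<forall>y. y \<bullet> e \<le> l \<longrightarrow> u (hrefl e l y) < u y \<longrightarrow> norm y < R \<longrightarrow> l - y \<bullet> e < d0) \<longrightarrow>
     (\<forall>y. y \<bullet> e \<le> l \<longrightarrow> u y \<le> u (hrefl e l y))"
    using reflection_maximum_principle by blast
  have "e \<noteq> 0" using e by auto
  then obtain t0 where t0: "0 < t0" "measure lborel ({y. \<bar>y \<bullet> e - l\<bar> \<le> t0} \<inter> ball 0 R) \<le> \<delta>"
    using \<delta>(1) by (rule strip_measure_small)
  \<comment> \<open>The strip runs from \<open>l - t\<close> to at most \<open>l + t\<close>:
    \<open>t \<le> t0\<close> makes its measure small and \<open>t \<le> d0 / 3\<close> its width
    less than \<open>d0\<close>.\<close>
  define t where "t = min t0 (d0 / 3)"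
  have t: "0 < t" "t \<le> t0" "2 * t < d0" using t0 \<delta> by (auto simp: t_def)
  define K where "K = {y. y \<bullet> e \<le> l - t} \<inter> cball 0 R"
  have K: "compact K" unfolding K_def
    by (intro closed_Int_compact compact_cball closed_Collect_le continuous_intros)
  define F where "F z = u (hrefl e (snd z) (fst z)) - u (fst z)" for z
  have F: "continuous_on (K \<times> {l..l + 1}) F"
    unfolding F_def hrefl_def by (intro continuous_intros continuous_on_compose2[OF u_cont[of UNIV]]) auto
  have "\<exists>b>0. \<forall>y\<in>K. b \<le> F (y, l)"
  proof (cases "K = {}")
    case False
    have "continuous_on K (\<lambda>y. F (y, l))"
      by (rule continuous_on_compose2[OF F]) (auto intro: continuous_intros)
    then obtain y1 where y1: "y1 \<in> K" "\<And>y. y \<in> K \<Longrightarrow> F (y1, l) \<le> F (y, l)"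
      using continuous_attains_inf[OF K False] by blast
    have "0 < F (y1, l)" using strict[of y1] y1(1) t by (simp add: F_def K_def)
    then show ?thesis using y1(2) by blast
  qed (auto intro: exI[of _ 1])
  then obtain b where b: "0 < b" "\<And>y. y \<in> K \<Longrightarrow> b \<le> F (y, l)" by blast
  have "uniformly_continuous_on (K \<times> {l..l + 1}) F"
    by (intro compact_uniformly_continuous F compact_Times K compact_Icc)
  then obtain t2 where t2: "0 < t2"
    "\<And>z z'. z \<in> K \<times> {l..l + 1} \<Longrightarrow> z' \<in> K \<times> {l..l + 1} \<Longrightarrow> dist z' z < t2 \<Longrightarrow> dist (F z') (F z) < b"
    using b(1) unfolding uniformly_continuous_on_def by metis
  show thesis
  proof (rule that[of "min t (min (t2 / 2) 1)"])
    show "0 < min t (min (t2 / 2) 1)" using t t2 by simp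
    fix m y assume m: "l \<le> m" "m \<le> l + min t (min (t2 / 2) 1)" and y: "y \<bullet> e \<le> m"
    define S where "S = {y. y \<bullet> e \<le> m \<and> u (hrefl e m y) < u y}"
    have strip: "l - t < y \<bullet> e" if "y \<in> S" "norm y < R" for y
    proof (rule ccontr)
      assume "\<not> ?thesis"
      then have yK: "y \<in> K" using that by (simp add: K_def)
      have "dist (y, m) (y, l) < t2" using m t2(1) by (simp add: dist_Pair_Pair dist_real_def)
      then have "dist (F (y, m)) (F (y, l)) < b" using yK m by (intro t2(2)) auto
      then have "0 < F (y, m)" using b(2)[OF yK] by (simp add: dist_real_def)
      then show False using that by (simp add: F_def S_def)
    qed
    have "S \<inter> ball 0 R \<subseteq> {y. \<bar>y \<bullet> e - l\<bar> \<le> t0} \<inter> ball 0 R"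
    proof
      fix y assume y: "y \<in> S \<inter> ball 0 R"
      moreover have "m \<le> l + t" using m by simp
      ultimately have "y \<bullet> e \<le> l + t" by (simp add: S_def)
      with strip[of y] y t show "y \<in> {y. \<bar>y \<bullet> e - l\<bar> \<le> t0} \<inter> ball 0 R" by auto
    qed
    then have "measure lborel (S \<inter> ball 0 R) \<le> measure lborel ({y. \<bar>y \<bullet> e - l\<bar> \<le> t0} \<inter> ball 0 R)"
    proof (rule measure_mono_fmeasurable)
      show "S \<inter> ball 0 R \<in> sets lborel" unfolding S_def by measurable
      have "bounded ({y. \<bar>y \<bullet> e - l\<bar> \<le> t0} \<inter> ball 0 R)" by (rule bounded_Int) simp
      moreover have "{y. \<bar>y \<bullet> e - l\<bar> \<le> t0} \<inter> ball 0 R \<in> sets lborel" by measurable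
      ultimately show "{y. \<bar>y \<bullet> e - l\<bar> \<le> t0} \<inter> ball 0 R \<in> fmeasurable lborel"
        using emeasure_bounded_finite by (auto simp: fmeasurable_def)
    qed
    then have meas: "measure lborel (S \<inter> ball 0 R) \<le> \<delta>" using t0 by linarith
    have "m - y \<bullet> e < d0" if "y \<in> S" "norm y < R" for y
      using strip[OF that] m t by auto
    then have "\<forall>y. y \<bullet> e \<le> m \<longrightarrow> u (hrefl e m y) < u y \<longrightarrow> norm y < R \<longrightarrow> m - y \<bullet> e < d0"
      by (auto simp: S_def)
    then show "u y \<le> u (hrefl e m y)" using mp e y meas unfolding S_def by blast
  qed
qed

text \<open>The level is the supremum of those up to which the inequality holds throughout. It is
  finite, since a plane too far out would reflect the origin to a point where
  \<open>u < u 0\<close>. By continuity the inequality holds at the supremum; if it were strict at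
  one point it would be strict everywhere, and \<open>reflection_extend\<close> would pass the
  supremum.\<close>

lemma reflection_symmetric:
  assumes e: "norm e = 1"
  obtains l where "\<And>y. u (hrefl e l y) = u y"
    "\<And>m y. m \<le> l \<Longrightarrow> y \<bullet> e \<le> m \<Longrightarrow> u y \<le> u (hrefl e m y)"
proof -
  define \<Lambda> where "\<Lambda> = {l. \<forall>m\<le>l. \<forall>y. y \<bullet> e \<le> m \<longrightarrow> u y \<le> u (hrefl e m y)}"
  obtain l0 where "\<And>l y. l \<le> l0 \<Longrightarrow> y \<bullet> e \<le> l \<Longrightarrow> u y \<le> u (hrefl e l y)"
    using reflection_start[OF e] by blast
  then have l0: "l0 \<in> \<Lambda>" by (simp add: \<Lambda>_def)
  have "eventually (\<lambda>y. u y < u 0) at_infinity"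
    by (intro order_tendstoD(2)[OF u_lim] u_pos)
  then obtain b where b: "\<And>y. norm y \<ge> b \<Longrightarrow> u y < u 0" by (auto simp: eventually_at_infinity)
  have bdd: "l \<le> \<bar>b\<bar>" if "l \<in> \<Lambda>" for l
  proof (rule ccontr)
    assume l: "\<not> l \<le> \<bar>b\<bar>"
    then have "u 0 \<le> u (hrefl e l 0)" using that by (simp add: \<Lambda>_def)
    moreover have "norm (hrefl e l 0) \<ge> b" using l e by (simp add: hrefl_def)
    ultimately show False using b[of "hrefl e l 0"] by simp
  qed
  then have bdd': "bdd_above \<Lambda>" by (auto simp: bdd_above_def)
  define l where "l = Sup \<Lambda>"
  have below: "u y \<le> u (hrefl e m y)" if ml: "m < l" "y \<bullet> e \<le> m" for m y
  proof -
    obtain l' where "l' \<in> \<Lambda>" "m < l'" using ml(1) l0 bdd' less_cSup_iff[of \<Lambda> m] unfolding l_def by blast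
    then show ?thesis using ml by (simp add: \<Lambda>_def)
  qed
  have at: "u y \<le> u (hrefl e l y)" if y: "y \<bullet> e \<le> l" for y
  proof (cases "y \<bullet> e = l")
    case True
    then show ?thesis by (simp add: hrefl_def)
  next
    case False
    then have lt: "y \<bullet> e < l" using y by simp
    have "isCont (\<lambda>m. u (hrefl e m y)) l"
      unfolding hrefl_def
      by (rule continuous_on_interior[of UNIV])
         (auto intro!: continuous_intros continuous_on_compose2[OF u_cont[of UNIV]])
    then have "((\<lambda>m. u (hrefl e m y)) \<longlongrightarrow> u (hrefl e l y)) (at_left l)"
      unfolding isCont_def by (rule tendsto_mono[rotated]) (simp add: at_le)
    moreover have "eventually (\<lambda>m. u y \<le> u (hrefl e m y)) (at_left l)"
      using eventually_at_left_real[OF lt] by eventually_elim (auto intro!: below)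
    ultimately show ?thesis by (rule tendsto_lowerbound) simp
  qed
  have le: "u y \<le> u (hrefl e m y)" if "m \<le> l" "y \<bullet> e \<le> m" for m y
    using below[of m y] at[of y] that by (cases "m = l") auto
  have no_gap: "u (hrefl e l y) = u y" if y: "y \<bullet> e < l" for y
  proof (rule ccontr)
    assume "u (hrefl e l y) \<noteq> u y"
    then have lt: "u y < u (hrefl e l y)" using at[of y] y by simp
    obtain \<tau> where \<tau>: "0 < \<tau>"
      and ext: "\<And>m y. l \<le> m \<Longrightarrow> m \<le> l + \<tau> \<Longrightarrow> y \<bullet> e \<le> m \<Longrightarrow> u y \<le> u (hrefl e m y)"
      using reflection_extend[OF e reflection_strict[OF e at y lt]] by blast
    have "u y \<le> u (hrefl e m y)" if "m \<le> l + \<tau>" "y \<bullet> e \<le> m" for m y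
      using le[of m y] ext[of m y] that by (cases "m \<le> l") auto
    then have "l + \<tau> \<in> \<Lambda>" by (simp add: \<Lambda>_def)
    then have "l + \<tau> \<le> l" unfolding l_def by (rule cSup_upper[OF _ bdd'])
    then show False using \<tau> by simp
  qed
  have "u (hrefl e l y) = u y" for y
  proof (rule hrefl_symmetric_cases[OF e, of "\<lambda>y. u (hrefl e l y) = u y" l])
    fix y assume "y \<bullet> e \<le> l"
    then show "u (hrefl e l y) = u y" using no_gap[of y] by (cases "y \<bullet> e = l") (auto simp: hrefl_def)
  qed (simp add: hrefl_hrefl e)
  then show thesis using le by (rule that)
qed

end

subsection \<open>Symmetry in all directions\<close>

text \<open>The symmetry planes of the coordinate directions meet in \<open>x0\<close>, and their
  reflections compose to the point reflection there. All other symmetry planes then pass through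
  \<open>x0\<close> as well, and two points equidistant from \<open>x0\<close> are exchanged by one
  of them.\<close>

lemma radial_of_reflection_symmetries:
  fixes u :: "'a::euclidean_space \<Rightarrow> real"
  assumes pos: "\<And>x. 0 < u x" and lim: "(u \<longlongrightarrow> 0) at_infinity"
    and sym: "\<And>e. norm e = 1 \<Longrightarrow> \<exists>l. (\<forall>y. u (hrefl e l y) = u y) \<and>
      (\<forall>m\<le>l. \<forall>y. y \<bullet> e \<le> m \<longrightarrow> u y \<le> u (hrefl e m y))"
  shows "\<exists>x0 \<phi>. antimono_on {0..} \<phi> \<and> (\<forall>x. u x = \<phi> (norm (x - x0)))"
proof -
  obtain L where L: "\<And>e y. norm e = 1 \<Longrightarrow> u (hrefl e (L e) y) = u y"
    and mono: "\<And>e m y. norm e = 1 \<Longrightarrow> m \<le> L e \<Longrightarrow> y \<bullet> e \<le> m \<Longrightarrow> u y \<le> u (hrefl e m y)"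
    using sym by metis
  define x0 where "x0 = (\<Sum>b\<in>Basis. L b *\<^sub>R b)"
  \<comment> \<open>The displacements already made are orthogonal to the new basis vector
    \<open>c\<close>, so reflecting in direction \<open>c\<close> changes only that coordinate and
    uses its original value.\<close>
  have step: "u (x + (\<Sum>b\<in>F. (2 * (L b - x \<bullet> b)) *\<^sub>R b)) = u x" if "finite F" "F \<subseteq> Basis" for x F
    using that
  proof (induction F)
    case (insert c F)
    let ?y = "x + (\<Sum>b\<in>F. (2 * (L b - x \<bullet> b)) *\<^sub>R b)"
    have "(\<Sum>b\<in>F. (2 * (L b - x \<bullet> b)) *\<^sub>R b) \<bullet> c = 0"
      using insert by (auto simp: inner_sum_left inner_Basis intro!: sum.neutral)
    then have "hrefl c (L c) ?y = x + (\<Sum>b\<in>insert c F. (2 * (L b - x \<bullet> b)) *\<^sub>R b)"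
      using insert by (simp add: hrefl_def inner_add_left algebra_simps)
    moreover have "u (hrefl c (L c) ?y) = u ?y" using insert by (intro L) auto
    ultimately show ?case using insert by simp
  qed simp
  have point: "u (2 *\<^sub>R x0 - x) = u x" for x
  proof -
    have "x + (\<Sum>b\<in>Basis. (2 * (L b - x \<bullet> b)) *\<^sub>R b) = x + 2 *\<^sub>R x0 - 2 *\<^sub>R (\<Sum>b\<in>Basis. (x \<bullet> b) *\<^sub>R b)"
      by (simp add: x0_def scaleR_sum_right algebra_simps sum_subtractf)
    also have "\<dots> = 2 *\<^sub>R x0 - x" by (simp add: euclidean_representation scaleR_2)
    finally show ?thesis using step[of Basis x] by simp
  qed
  text \<open>Otherwise \<open>u\<close> would be periodic: the square of the composition of the point reflection with
    the hyperplane reflection is a translation along \<open>e\<close>.\<close>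
  have centre: "L e = x0 \<bullet> e" if e: "norm e = 1" for e
  proof (rule ccontr)
    assume ne: "L e \<noteq> x0 \<bullet> e"
    define B where "B x = 2 *\<^sub>R x0 - hrefl e (L e) x" for x
    have uB: "u (B x) = u x" for x by (simp add: B_def point L e)
    define c where "c = (4 * (x0 \<bullet> e - L e)) *\<^sub>R e"
    have "e \<bullet> e = 1" using e by (simp add: dot_square_norm)
    then have "B (B x) = x + c" for x
      by (simp add: B_def c_def hrefl_def inner_diff_left inner_add_left algebra_simps flip: scaleR_add_left)
    then have per: "u (x + c) = u x" for x using uB by metis
    have "u (real n *\<^sub>R c) = u 0" for n
    proof (induction n)
      case (Suc n)
      then show ?case using per[of "real n *\<^sub>R c"] by (simp add: algebra_simps)
    qed simp
    moreover have "filterlim (\<lambda>n. real n *\<^sub>R c) at_infinity sequentially"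
    proof -
      have "0 < norm c" using ne e by (simp add: c_def)
      then have "filterlim (\<lambda>n. norm c * real n) at_top sequentially"
        by (intro filterlim_tendsto_pos_mult_at_top[OF tendsto_const]) (auto simp: filterlim_real_sequentially)
      then show ?thesis
        by (intro filterlim_norm_at_top_imp_at_infinity) (simp add: mult.commute)
    qed
    ultimately have "(\<lambda>n::nat. u 0) \<longlonglongrightarrow> 0"
      using filterlim_compose[OF lim] by fastforce
    then have "u 0 = 0" by (simp add: LIMSEQ_const_iff)
    then show False using pos[of 0] by simp
  qed
  have radial: "u x = u y" if xy: "norm (x - x0) = norm (y - x0)" for x y
  proof (cases "x = y")
    case False
    \<comment> \<open>For equidistant points the plane through \<open>x0\<close> orthogonal to
      \<open>y - x\<close> is their perpendicular bisector, hence its reflection sends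
      \<open>x\<close> to \<open>y\<close>.\<close>
    define d where "d = norm (y - x)"
    define e where "e = (1 / d) *\<^sub>R (y - x)"
    have d: "0 < d" using False by (simp add: d_def)
    have e: "norm e = 1" using d by (simp add: e_def d_def)
    have yx: "y = x + d *\<^sub>R e" using d by (simp add: e_def)
    have ee: "e \<bullet> e = 1" using e by (simp add: dot_square_norm)
    have "(norm (x - x0 + d *\<^sub>R e))\<^sup>2 = (norm (x - x0))\<^sup>2"
      using xy yx by (simp add: algebra_simps)
    then have "d * (2 * ((x - x0) \<bullet> e) + d) = 0"
      unfolding power2_norm_eq_inner
      by (simp add: inner_add_left inner_add_right ee inner_commute algebra_simps)
    then have "2 * (x0 \<bullet> e - x \<bullet> e) = d" using d by (simp add: inner_diff_left)
    then have "hrefl e (L e) x = y" by (simp add: hrefl_def centre e yx)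
    then show ?thesis using L[OF e, of x] by simp
  qed simp
  obtain e :: 'a where "e \<in> Basis" using nonempty_Basis by blast
  then have e: "norm e = 1" by simp
  then have ee: "e \<bullet> e = 1" by (simp add: dot_square_norm)
  define \<phi> where "\<phi> r = u (x0 - r *\<^sub>R e)" for r
  have "antimono_on {0..} \<phi>"
  proof (rule monotone_onI)
    fix r s :: real assume rs: "r \<in> {0..}" "s \<in> {0..}" "r \<le> s"
    \<comment> \<open>The plane halfway between the points at distances \<open>s\<close> and
      \<open>r\<close> from \<open>x0\<close>. The ray points along \<open>- e\<close> because the
      inequality is available only for levels up to \<open>x0 \<bullet> e\<close>, which
      \<open>?m\<close> respects as \<open>r\<close> and \<open>s\<close> are nonnegative.\<close>
    let ?m = "x0 \<bullet> e - (r + s) / 2" and ?x = "x0 - s *\<^sub>R e"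
    have "u ?x \<le> u (hrefl e ?m ?x)"
      using rs by (intro mono e) (auto simp: centre e ee inner_diff_left)
    also have "hrefl e ?m ?x = x0 - r *\<^sub>R e"
      by (simp add: hrefl_def inner_diff_left ee algebra_simps flip: scaleR_add_left)
    finally show "\<phi> s \<le> \<phi> r" by (simp add: \<phi>_def)
  qed
  moreover have "u x = \<phi> (norm (x - x0))" for x
    unfolding \<phi>_def by (rule radial) (simp add: e)
  ultimately show ?thesis by blast
qed

section \<open>Reduction of the theorem to the moving-plane setting\<close>

theorem theorem1p1:
  fixes u v :: "real ^ 'n \<Rightarrow> real"
    and \<alpha> \<beta> p \<gamma> C1 C2 a :: real
  assumes "CARD('n) \<ge> 2"
    and "0 < \<alpha>" "\<alpha> < 2" and "0 < \<beta>" "\<beta> < 2" and "1 < p"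
    and "C11_loc u" "u \<in> L_space \<alpha>"
    and "C11_loc v" "v \<in> L_space \<beta>"
    and "\<And>x. v x = riesz_potential \<beta> (\<lambda>y. u y powr p) x"
    and "\<And>x. frac_laplacian \<alpha> u x + u x = v x * u x powr (p - 1)"
    and "\<And>x. frac_laplacian \<beta> v x = u x powr p"
    and "\<And>x. u x > 0" "\<And>x. v x > 0"
    and "\<gamma> > \<beta> / (p - 1)"
    and "\<forall>\<^sub>F x in at_infinity. C1 / norm x powr \<gamma> \<le> u x \<and> u x \<le> C2 / norm x powr \<gamma>"
    and "((\<lambda>x. u x powr (p - 2) * v x) \<longlongrightarrow> a) at_infinity"
    and "a < C1 / (C2 * p)"
  shows "\<exists>x0 \<phi>. antimono_on {0..} \<phi> \<and> (\<forall>x. u x = \<phi> (norm (x - x0)))"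
proof -
  have "0 < \<beta> / (p - 1)" using assms(4,6) by simp
  then have \<gamma>: "0 < \<gamma>" using assms(16) by linarith
  obtain L where bounds: "\<And>x. norm x \<ge> L \<Longrightarrow> C1 / norm x powr \<gamma> \<le> u x \<and> u x \<le> C2 / norm x powr \<gamma>"
    using assms(17) by (auto simp: eventually_at_infinity)
  \<comment> \<open>A single point far out already gives \<open>C2 > 0\<close> and
    \<open>C1 \<le> C2\<close>, whence \<open>C1 / (C2 * p) \<le> 1 / p\<close> and
    \<open>a * p < 1\<close>. Taking \<open>norm z \<ge> 1\<close> keeps the denominators
    positive.\<close>
  obtain z :: "real^'n" where z: "norm z = max L 1"
    using vector_choose_size[of "max L 1"] by (metis max.cobounded2 order_trans zero_le_one)
  have "0 < C2 / norm z powr \<gamma>" "C1 / norm z powr \<gamma> \<le> C2 / norm z powr \<gamma>"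
    using bounds[of z] z assms(14)[of z] by auto
  moreover have "0 < norm z powr \<gamma>" using z by simp
  ultimately have C2: "0 < C2" and C12: "C1 \<le> C2"
    by (auto simp: zero_less_divide_iff divide_le_cancel)
  have "C1 / (C2 * p) \<le> C2 / (C2 * p)"
    using C2 C12 assms(6) by (intro divide_right_mono) auto
  also have "\<dots> = 1 / p" using C2 by simp
  finally have "a * p < 1" using assms(6,19) by (simp add: pos_less_divide_eq[symmetric])
  have decay: "u y powr (p - 1) \<le> C2 powr (p - 1) * rker (\<gamma> * (p - 1)) y" if "norm y \<ge> L" for y
  proof -
    have "u y powr (p - 1) \<le> (C2 / norm y powr \<gamma>) powr (p - 1)"
      using bounds[OF that] assms(14)[of y] assms(6) by (intro powr_mono2) auto
    also have "\<dots> = C2 powr (p - 1) * rker (\<gamma> * (p - 1)) y"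
      using C2 by (simp add: rker_def powr_divide powr_powr)
    finally show ?thesis .
  qed
  have "((\<lambda>x::real^'n. C2 * norm x powr (- \<gamma>)) \<longlongrightarrow> C2 * 0) at_infinity"
    using \<gamma> by (intro tendsto_intros tendsto_neg_powr filterlim_norm_at_top) auto
  then have up: "((\<lambda>x::real^'n. C2 * norm x powr (- \<gamma>)) \<longlongrightarrow> 0) at_infinity" by simp
  have lo: "\<forall>\<^sub>F x in at_infinity. 0 \<le> u x"
    using assms(14) by (auto intro: always_eventually less_imp_le)
  have hi: "\<forall>\<^sub>F x in at_infinity. u x \<le> C2 * norm x powr (- \<gamma>)"
    using assms(17) by eventually_elim (simp add: powr_minus_divide)
  have u0: "(u \<longlongrightarrow> 0) at_infinity"
    by (rule tendsto_sandwich[OF lo hi tendsto_const up])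
  interpret hartree_system u v \<alpha> \<beta> p "\<gamma> * (p - 1)" "C2 powr (p - 1)" L a
  proof
    show "continuous_on UNIV v" using assms(9) by (rule C11_loc_continuous)
    show "\<beta> < \<gamma> * (p - 1)" using assms(6,16) by (simp add: pos_divide_less_eq)
  qed (use assms decay u0 \<open>a * p < 1\<close> in auto)
  show ?thesis
  proof (rule radial_of_reflection_symmetries[OF assms(14) u0])
    fix e :: "real^'n" assume "norm e = 1"
    then show "\<exists>l. (\<forall>y. u (hrefl e l y) = u y) \<and>
      (\<forall>m\<le>l. \<forall>y. y \<bullet> e \<le> m \<longrightarrow> u y \<le> u (hrefl e m y))"
      by (rule reflection_symmetric) blast
  qed
qed

end
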